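(* Let $(\Omega,d,\mu)$ be an $RD$-space, $X$ an r.i. space on $\Omega$, $E$ a parameter, $b\in SV$ and $0<\theta<\infty$. Then $$\mathring{B}_{X,L^{1}}^{\theta,b}\subset\mathring{B}_{X,E}^{\theta,b}\subset\mathring{B}_{X,L^{\infty}}^{\theta,b}$$ and $$B_{X,L^{1}}^{\theta,b}\subset B_{X,E}^{\theta,b}\subset B_{X,L^{\infty}}^{\theta,b}.$$
   Context: Metric measure space: $(\Omega,d)$ is a metric space with a Borel measure $\mu$ (induced by a Borel regular outer measure) such that $0<\mu(B)<\infty$ for every ball $B$ and $\mu(\{x\})=0$ for all $x\in\Omega$; $B(x,r)=\{y:d(x,y)<r\}$. It is an $RD$-space with indices $(k,n)$, $0<k\le n$, if there are constants $0<C_1\le 1\le C_2$ with $C_1\lambda^k\mu(B(x,r))\le\mu(B(x,\lambda r))\le C_2\lambda^n\mu(B(x,r))$ for all $x\in\Omega$, $r>0$, $\lambda\ge1$. R.i. space: a Banach function space $X$ on $(\Omega,\mu)$ with the Fatou property such that, if $g\in X$ and $f^*\le g^*$ a.e., then $f\in X$ and $\|f\|_X\le\|g\|_X$; here $f^*(s)=\inf\{t\ge0:\mu\{|f|>t\}\le s\}$ is the decreasing rearrangement. Parameter: an r.i. space $E$ on $(0,\infty)$ with Lebesgue measure. One assumes $E=\mathcal F(L^1,L^\infty)$ for an exact interpolation functor $\mathcal F$, and puts $\tilde E:=\mathcal F(\tilde L^1,L^\infty)$ where $\|g\|_{\tilde L^1}=\int_0^\infty|g(t)|\frac{dt}{t}$;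 $\tilde E$ is an r.i. space with respect to $dt/t$, and concretely $\|g\|_{\tilde E(0,1)}=\|g(e^{-u})\|_{E(0,\infty)}$, $\|g\|_{\tilde E(1,\infty)}=\|g(e^{u})\|_{E(0,\infty)}$, $\|g\|_{\tilde E}\simeq\|g\|_{\tilde E(0,1)}+\|g\|_{\tilde E(1,\infty)}$, where $\|g\|_{\tilde E(I)}=\|g\chi_I\|_{\tilde E}$. For $E=L^q$, $\tilde E=L^q((0,\infty),dt/t)$; $\tilde L^\infty=L^\infty$. $b\in SV$ (slowly varying): $b$ is a positive Lebesgue measurable function on $(0,\infty)$ such that for every $\varepsilon>0$, $t^\varepsilon b(t)$ is equivalent (up to multiplicative constants) to an increasing function and $t^{-\varepsilon}b(t)$ to a decreasing function on $(0,\infty)$. Besov spaces: $E_X(f,t)=\left\|x\mapsto\frac1{\mu(B(x,t))}\int_{B(x,t)}|f(x)-f(y)|\,d\mu(y)\right\|_X$. $\mathring B^{\theta,b}_{X,E}$ is the set of $f\in L^1+L^\infty$ with $\|f\|_{\mathring B^{\theta,b}_{X,E}}=\|t^{-\theta}b(t)E_X(f,t)\|_{\tilde E}<\infty$, and $B^{\theta,b}_{X,E}=\mathring B^{\theta,b}_{X,E}\cap X$ with $\|f\|_{B^{\theta,b}_{X,E}}=\|t^{-\theta}b(t)E_X(f,t)\|_{\tilde E(0,1)}+\|f\|_X$. *)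

theory Defs
  imports "HOL-Analysis.Analysis" "HOL-Probability.Essential_Supremum"
begin

section \<open>Metric measure spaces\<close>

text \<open>
  Countable additivity is built into \<^typ>\<open>'a measure\<close>.  Borel regularity is expressed on the
  measurable sets, so that both the Borel sets and the Caratheodory-measurable sets of a Borel
  regular outer measure are admitted as the domain of \<open>M\<close>.
\<close>

definition metric_measure_space :: "'a::metric_space measure \<Rightarrow> bool" where
  "metric_measure_space M \<longleftrightarrow>
     sets borel \<subseteq> sets M \<and>
     (\<forall>A\<in>sets M. \<exists>B\<in>sets borel. A \<subseteq> B \<and> emeasure M B = emeasure M A) \<and>
     (\<forall>x. \<forall>r>0. 0 < emeasure M (ball x r) \<and> emeasure M (ball x r) < \<infinity>) \<and>
     (\<forall>x. emeasure M {x} = 0)"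

definition RD_space :: "'a::metric_space measure \<Rightarrow> real \<Rightarrow> real \<Rightarrow> bool" where
  "RD_space M k n \<longleftrightarrow>
     metric_measure_space M \<and> 0 < k \<and> k \<le> n \<and>
     (\<exists>C1 C2. 0 < C1 \<and> C1 \<le> 1 \<and> 1 \<le> C2 \<and>
        (\<forall>x. \<forall>r>0. \<forall>s\<ge>1.
           C1 * s powr k * measure M (ball x r) \<le> measure M (ball x (s * r)) \<and>
           measure M (ball x (s * r)) \<le> C2 * s powr n * measure M (ball x r)))"

section \<open>Function norms\<close>

text \<open>
  A function space is given by its norm on the nonnegative extended-valued measurable functions,
  as a functional of type \<^typ>\<open>('a \<Rightarrow> ennreal) \<Rightarrow> ennreal\<close>; its elements are the real measurable
  functions \<open>f\<close> for which \<open>\<bar>f\<bar>\<close> has finite norm.  The values of the functional at nonmeasurable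
  functions are irrelevant.
\<close>

definition fnorm :: "(('a \<Rightarrow> ennreal) \<Rightarrow> ennreal) \<Rightarrow> ('a \<Rightarrow> real) \<Rightarrow> ennreal" where
  "fnorm \<rho> f = \<rho> (\<lambda>x. ennreal \<bar>f x\<bar>)"

definition fspace :: "'a measure \<Rightarrow> (('a \<Rightarrow> ennreal) \<Rightarrow> ennreal) \<Rightarrow> ('a \<Rightarrow> real) set" where
  "fspace M \<rho> = {f \<in> borel_measurable M. fnorm \<rho> f < \<infinity>}"

definition L1_norm :: "'a measure \<Rightarrow> ('a \<Rightarrow> ennreal) \<Rightarrow> ennreal" where
  "L1_norm M f = (\<integral>\<^sup>+x. f x \<partial>M)"

definition Linf_norm :: "'a measure \<Rightarrow> ('a \<Rightarrow> ennreal) \<Rightarrow> ennreal" where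
  "Linf_norm M f = esssup M f"

definition L1_plus_Linf :: "'a measure \<Rightarrow> ('a \<Rightarrow> real) set" where
  "L1_plus_Linf M =
     {(\<lambda>x. g x + h x) | g h. g \<in> fspace M (L1_norm M) \<and> h \<in> fspace M (Linf_norm M)}"

definition L1_plus_Linf_norm :: "'a measure \<Rightarrow> ('a \<Rightarrow> real) \<Rightarrow> ennreal" where
  "L1_plus_Linf_norm M f =
     Inf {fnorm (L1_norm M) g + fnorm (Linf_norm M) h | g h.
            g \<in> borel_measurable M \<and> h \<in> borel_measurable M \<and> (AE x in M. f x = g x + h x)}"

definition lattice_norm :: "'a measure \<Rightarrow> (('a \<Rightarrow> ennreal) \<Rightarrow> ennreal) \<Rightarrow> bool" where
  "lattice_norm M \<rho> \<longleftrightarrow>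
     (\<forall>f\<in>borel_measurable M. \<rho> f = 0 \<longleftrightarrow> (AE x in M. f x = 0)) \<and>
     (\<forall>f\<in>borel_measurable M. \<forall>c\<ge>0. \<rho> (\<lambda>x. ennreal c * f x) = ennreal c * \<rho> f) \<and>
     (\<forall>f\<in>borel_measurable M. \<forall>g\<in>borel_measurable M. \<rho> (\<lambda>x. f x + g x) \<le> \<rho> f + \<rho> g) \<and>
     (\<forall>f\<in>borel_measurable M. \<forall>g\<in>borel_measurable M. (AE x in M. f x \<le> g x) \<longrightarrow> \<rho> f \<le> \<rho> g)"

definition complete_norm :: "'a measure \<Rightarrow> (('a \<Rightarrow> ennreal) \<Rightarrow> ennreal) \<Rightarrow> bool" where
  "complete_norm M \<rho> \<longleftrightarrow>
     (\<forall>f::nat \<Rightarrow> 'a \<Rightarrow> real.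
        (\<forall>i. f i \<in> fspace M \<rho>) \<and>
        (\<forall>e>0. \<exists>N. \<forall>i\<ge>N. \<forall>j\<ge>N. fnorm \<rho> (\<lambda>x. f i x - f j x) < ennreal e) \<longrightarrow>
        (\<exists>g\<in>fspace M \<rho>. (\<lambda>i. fnorm \<rho> (\<lambda>x. f i x - g x)) \<longlonglongrightarrow> 0))"

text \<open>
  Banach function norms in the sense of Bennett and Sharpley; the first of the three clauses added
  to \<open>lattice_norm\<close> is the Fatou property, from which completeness follows.
\<close>

definition banach_function_norm :: "'a measure \<Rightarrow> (('a \<Rightarrow> ennreal) \<Rightarrow> ennreal) \<Rightarrow> bool" where
  "banach_function_norm M \<rho> \<longleftrightarrow>
     lattice_norm M \<rho> \<and>
     (\<forall>f::nat \<Rightarrow> 'a \<Rightarrow> ennreal. (\<forall>i. f i \<in> borel_measurable M) \<and> incseq f \<longrightarrow>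
        \<rho> (\<lambda>x. SUP i. f i x) = (SUP i. \<rho> (f i))) \<and>
     (\<forall>A\<in>sets M. emeasure M A < \<infinity> \<longrightarrow> \<rho> (indicator A) < \<infinity>) \<and>
     (\<forall>A\<in>sets M. emeasure M A < \<infinity> \<longrightarrow>
        (\<exists>C>0. \<forall>f\<in>borel_measurable M. (\<integral>\<^sup>+x\<in>A. f x \<partial>M) \<le> ennreal C * \<rho> f))"

definition rearrangement :: "'a measure \<Rightarrow> ('a \<Rightarrow> ennreal) \<Rightarrow> real \<Rightarrow> ennreal" where
  "rearrangement M f s = Inf {t. emeasure M {x \<in> space M. f x > t} \<le> ennreal s}"

abbreviation leb_pos :: "real measure" where
  "leb_pos \<equiv> lebesgue_on {0<..}"

definition ri_norm :: "'a measure \<Rightarrow> (('a \<Rightarrow> ennreal) \<Rightarrow> ennreal) \<Rightarrow> bool" where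
  "ri_norm M \<rho> \<longleftrightarrow>
     banach_function_norm M \<rho> \<and>
     (\<forall>f\<in>borel_measurable M. \<forall>g\<in>borel_measurable M.
        \<rho> g < \<infinity> \<and> (AE s in leb_pos. rearrangement M f s \<le> rearrangement M g s) \<longrightarrow> \<rho> f \<le> \<rho> g)"

section \<open>Exact interpolation functors and the parameter\<close>

text \<open>
  \<open>bounded_op M M' \<rho> \<rho>' c T\<close>: the operator \<open>T\<close> maps the space of \<open>\<rho>\<close> into that of \<open>\<rho>'\<close>, with
  norm at most \<open>c\<close>.
\<close>

definition bounded_op :: "'a measure \<Rightarrow> 'b measure \<Rightarrow> (('a \<Rightarrow> ennreal) \<Rightarrow> ennreal) \<Rightarrow>
    (('b \<Rightarrow> ennreal) \<Rightarrow> ennreal) \<Rightarrow> real \<Rightarrow> (('a \<Rightarrow> real) \<Rightarrow> ('b \<Rightarrow> real)) \<Rightarrow> bool" where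
  "bounded_op M M' \<rho> \<rho>' c T \<longleftrightarrow>
     (\<forall>f\<in>fspace M \<rho>. T f \<in> fspace M' \<rho>' \<and> fnorm \<rho>' (T f) \<le> ennreal c * fnorm \<rho> f)"

definition linear_op :: "'a measure \<Rightarrow> 'b measure \<Rightarrow> (('a \<Rightarrow> real) \<Rightarrow> ('b \<Rightarrow> real)) \<Rightarrow> bool" where
  "linear_op M M' T \<longleftrightarrow>
     (\<forall>f\<in>L1_plus_Linf M. T f \<in> borel_measurable M') \<and>
     (\<forall>f\<in>L1_plus_Linf M. \<forall>g\<in>L1_plus_Linf M. \<forall>a b.
        AE x in M'. T (\<lambda>y. a * f y + b * g y) x = a * T f x + b * T g x)"

text \<open>
  \<open>F \<nu>\<close> is the norm of the space assigned to the Banach couple \<open>(L\<^sup>1(\<nu>), L\<^sup>\<infinity>(\<nu>))\<close>, where \<open>\<nu>\<close> is a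
  sigma-finite measure on the type of real numbers: a functor on the full subcategory of these
  couples.  Every such functor extends to all Banach couples (Aronszajn-Gagliardo).  That \<open>F \<nu>\<close>
  depends on \<open>\<bar>f\<bar>\<close> only and is monotone is no restriction, since
  multiplication by a function bounded by 1 has norm at most 1 on \<open>L\<^sup>1(\<nu>)\<close> and on \<open>L\<^sup>\<infinity>(\<nu>)\<close>.
\<close>

definition exact_interpolation_functor ::
    "(real measure \<Rightarrow> (real \<Rightarrow> ennreal) \<Rightarrow> ennreal) \<Rightarrow> bool" where
  "exact_interpolation_functor F \<longleftrightarrow>
     (\<forall>\<nu>. sigma_finite_measure \<nu> \<longrightarrow>
        lattice_norm \<nu> (F \<nu>) \<and> complete_norm \<nu> (F \<nu>) \<and>
        (\<exists>C>0. \<forall>f\<in>fspace \<nu> (L1_norm \<nu>) \<inter> fspace \<nu> (Linf_norm \<nu>).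
           fnorm (F \<nu>) f \<le> ennreal C * max (fnorm (L1_norm \<nu>) f) (fnorm (Linf_norm \<nu>) f)) \<and>
        (\<exists>C>0. \<forall>f\<in>fspace \<nu> (F \<nu>).
           f \<in> L1_plus_Linf \<nu> \<and> L1_plus_Linf_norm \<nu> f \<le> ennreal C * fnorm (F \<nu>) f)) \<and>
     (\<forall>\<nu> \<nu>' T. \<forall>c\<ge>0. sigma_finite_measure \<nu> \<and> sigma_finite_measure \<nu>' \<and> linear_op \<nu> \<nu>' T \<and>
        bounded_op \<nu> \<nu>' (L1_norm \<nu>) (L1_norm \<nu>') c T \<and>
        bounded_op \<nu> \<nu>' (Linf_norm \<nu>) (Linf_norm \<nu>') c T \<longrightarrow>
        bounded_op \<nu> \<nu>' (F \<nu>) (F \<nu>') c T)"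

definition dt_over_t :: "real measure" where
  "dt_over_t = density leb_pos (\<lambda>t. ennreal (1 / t))"

text \<open>
  If \<open>E\<close> is \<open>F(L\<^sup>1, L\<^sup>\<infinity>)\<close> over \<open>((0,\<infinity>), dt)\<close>, then \<open>tilde F\<close> is the associated space over
  \<open>((0,\<infinity>), dt/t)\<close>.  In particular \<open>tilde L1_norm\<close> and \<open>tilde Linf_norm\<close> are the norms of
  \<open>L\<^sup>1(dt/t)\<close> and of \<open>L\<^sup>\<infinity>\<close>.
\<close>

definition tilde :: "(real measure \<Rightarrow> (real \<Rightarrow> ennreal) \<Rightarrow> ennreal) \<Rightarrow>
    (real \<Rightarrow> ennreal) \<Rightarrow> ennreal" where
  "tilde F = F dt_over_t"

section \<open>Slowly varying functions\<close>

definition equivalent_on_pos :: "(real \<Rightarrow> real) \<Rightarrow> (real \<Rightarrow> real) \<Rightarrow> bool" where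
  "equivalent_on_pos f g \<longleftrightarrow> (\<exists>c>0. \<exists>C>0. \<forall>t>0. c * g t \<le> f t \<and> f t \<le> C * g t)"

definition slowly_varying :: "(real \<Rightarrow> real) \<Rightarrow> bool" where
  "slowly_varying b \<longleftrightarrow>
     b \<in> borel_measurable leb_pos \<and> (\<forall>t>0. b t > 0) \<and>
     (\<forall>\<epsilon>>0.
        (\<exists>g. mono_on {0<..} g \<and> equivalent_on_pos (\<lambda>t. t powr \<epsilon> * b t) g) \<and>
        (\<exists>g. antimono_on {0<..} g \<and> equivalent_on_pos (\<lambda>t. t powr (-\<epsilon>) * b t) g))"

section \<open>Besov spaces\<close>

definition modulus :: "'a::metric_space measure \<Rightarrow> (('a \<Rightarrow> ennreal) \<Rightarrow> ennreal) \<Rightarrow>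
    ('a \<Rightarrow> real) \<Rightarrow> real \<Rightarrow> ennreal" where
  "modulus M X f t =
     X (\<lambda>x. (\<integral>\<^sup>+y\<in>ball x t. ennreal \<bar>f x - f y\<bar> \<partial>M) / emeasure M (ball x t))"

text \<open>
  In the following definitions \<open>N\<close> is a norm over \<open>((0,\<infinity>), dt/t)\<close>, to be instantiated with some \<open>tilde F\<close>.
\<close>

definition hom_besov_norm :: "'a::metric_space measure \<Rightarrow> (('a \<Rightarrow> ennreal) \<Rightarrow> ennreal) \<Rightarrow>
    ((real \<Rightarrow> ennreal) \<Rightarrow> ennreal) \<Rightarrow> real \<Rightarrow> (real \<Rightarrow> real) \<Rightarrow> ('a \<Rightarrow> real) \<Rightarrow> ennreal" where
  "hom_besov_norm M X N \<theta> b f = N (\<lambda>t. ennreal (t powr (-\<theta>) * b t) * modulus M X f t)"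

definition hom_besov :: "'a::metric_space measure \<Rightarrow> (('a \<Rightarrow> ennreal) \<Rightarrow> ennreal) \<Rightarrow>
    ((real \<Rightarrow> ennreal) \<Rightarrow> ennreal) \<Rightarrow> real \<Rightarrow> (real \<Rightarrow> real) \<Rightarrow> ('a \<Rightarrow> real) set" where
  "hom_besov M X N \<theta> b = {f \<in> L1_plus_Linf M. hom_besov_norm M X N \<theta> b f < \<infinity>}"

definition besov_norm :: "'a::metric_space measure \<Rightarrow> (('a \<Rightarrow> ennreal) \<Rightarrow> ennreal) \<Rightarrow>
    ((real \<Rightarrow> ennreal) \<Rightarrow> ennreal) \<Rightarrow> real \<Rightarrow> (real \<Rightarrow> real) \<Rightarrow> ('a \<Rightarrow> real) \<Rightarrow> ennreal" where
  "besov_norm M X N \<theta> b f =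
     N (\<lambda>t. ennreal (t powr (-\<theta>) * b t) * modulus M X f t * indicator {0<..<1} t) + fnorm X f"

definition besov :: "'a::metric_space measure \<Rightarrow> (('a \<Rightarrow> ennreal) \<Rightarrow> ennreal) \<Rightarrow>
    ((real \<Rightarrow> ennreal) \<Rightarrow> ennreal) \<Rightarrow> real \<Rightarrow> (real \<Rightarrow> real) \<Rightarrow> ('a \<Rightarrow> real) set" where
  "besov M X N \<theta> b = hom_besov M X N \<theta> b \<inter> fspace M X"

text \<open>Inclusions between normed (or seminormed) spaces are understood to be continuous.\<close>

definition embedded :: "'c set \<Rightarrow> ('c \<Rightarrow> ennreal) \<Rightarrow> 'c set \<Rightarrow> ('c \<Rightarrow> ennreal) \<Rightarrow> bool" where
  "embedded A nA B nB \<longleftrightarrow> A \<subseteq> B \<and> (\<exists>C>0. \<forall>f\<in>A. nB f \<le> ennreal C * nA f)"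

end

theory Submission
  imports Defs "HOL-Real_Asymp.Real_Asymp"
begin

text \<open>
  Put \<open>\<phi>(t) = t\<^sup>-\<^sup>\<theta> b(t) E\<^sub>X(f,t)\<close>.  By doubling and slow variation, \<open>\<phi>(s) \<le> K \<phi>(t)\<close> for
  \<open>s \<le> t \<le> 2s\<close>.  Integrating over \<open>[s, 2s]\<close> gives \<open>\<parallel>\<phi>\<parallel>\<^sub>\<infinity> \<le> 2K \<parallel>\<phi>\<parallel>\<^sub>1\<close> with respect to \<open>dt/t\<close>, and the
  first inclusion follows from \<open>L\<^sup>1 \<inter> L\<^sup>\<infinity> \<subseteq> F(L\<^sup>1, L\<^sup>\<infinity>)\<close>.  The second one follows from
  \<open>\<phi>(s) \<chi> \<le> K \<phi>\<close>, where \<open>\<chi>\<close> is the indicator of \<open>[s, 2s]\<close>, because the embedding into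
  \<open>L\<^sup>1 + L\<^sup>\<infinity>\<close> bounds the norm of \<open>\<chi>\<close> from below uniformly in \<open>s\<close>.

  For the inhomogeneous norms the argument fails for \<open>s \<in> [1/2, 1)\<close>, where \<open>\<phi>(s) \<le> K \<phi>(1)\<close> is
  estimated by \<open>\<parallel>f\<parallel>\<^sub>X\<close>.  This is the boundedness on \<open>X\<close> of the averages over balls of radius 1, which
  is obtained without interpolation: \<open>\<Omega>\<close> is covered by balls \<open>S\<^sub>i\<close> of bounded overlap, and for simple
  \<open>f\<close> each \<open>S\<^sub>i\<close> is cut into pieces of comparable measure on which \<open>f\<close> is constant.  The mean of \<open>f\<close>
  over \<open>S\<^sub>i\<close> is then comparable to the average of the functions that arise by shifting the values of
  \<open>f\<close> cyclically among the pieces, and the distribution function of each of these is bounded by a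
  multiple of that of \<open>f\<close>.
\<close>

section \<open>Doubling metric measure spaces\<close>

lemma ennreal_divide_left_mono:
  fixes a b c :: ennreal
  assumes "b \<le> c"
  shows "a / c \<le> a / b"
proof (cases "b = 0 \<or> b = top")
  case True
  then show ?thesis using assms by (cases "a = 0") (auto simp: top_unique)
next
  case False
  then have "a = a * b / b" by (simp add: ennreal_mult_divide_eq)
  also have "\<dots> \<le> a * c / b" using assms by (intro divide_right_mono_ennreal mult_left_mono) auto
  also have "\<dots> = c * (a / b)" by (simp add: ennreal_times_divide mult.commute)
  finally show ?thesis
    using False assms by (intro divide_le_posI_ennreal) (auto simp: zero_less_iff_neq_zero)
qed

text \<open>Compares averages over two balls: \<open>a\<close> and \<open>b\<close> stand for the
  integrals, \<open>c\<close> and \<open>d\<close> for the measures, \<open>K\<close> for the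
  doubling factor. Writing \<open>b\<close> as \<open>b * d / d\<close> brings in the second
  measure, which must be neither 0 nor infinite to cancel.\<close>

lemma ennreal_divide_le_mult_divide:
  fixes a b c d K :: ennreal
  assumes "a \<le> b" "d \<le> K * c" "d \<noteq> 0" "d \<noteq> top" "c \<noteq> 0"
  shows "a / c \<le> K * (b / d)"
proof -
  have "b = b * d / d" using assms by (simp add: ennreal_mult_divide_eq)
  also have "\<dots> \<le> b * (K * c) / d"
    by (intro divide_right_mono_ennreal mult_left_mono assms) simp
  also have "\<dots> = c * (K * (b / d))" by (simp add: ennreal_times_divide ac_simps)
  finally have "a \<le> c * (K * (b / d))" using assms by simp
  then show ?thesis using assms by (intro divide_le_posI_ennreal) (auto simp: zero_less_iff_neq_zero)
qed

locale doubling_space =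
  fixes M :: "'a::metric_space measure" and C n :: real
  assumes borel_sets: "sets borel \<subseteq> sets M"
    and ball_pos: "\<And>x r. r > 0 \<Longrightarrow> 0 < emeasure M (ball x r)"
    and ball_finite: "r > 0 \<Longrightarrow> emeasure M (ball x r) < \<infinity>"
    and emeasure_singleton: "emeasure M {x} = 0"
    and C_ge_1: "1 \<le> C"
    and doubling: "r > 0 \<Longrightarrow> s \<ge> 1 \<Longrightarrow>
          measure M (ball x (s * r)) \<le> C * s powr n * measure M (ball x r)"
begin

lemma space_M [simp]: "space M = UNIV"
proof -
  have "UNIV \<in> sets M" using borel_sets sets.top[of borel] by auto
  then show ?thesis using sets.sets_into_space by blast
qed

lemma borel_setsI: "A \<in> sets borel \<Longrightarrow> A \<in> sets M"
  using borel_sets by blast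

lemma ball_sets [measurable, simp]: "ball x r \<in> sets M"
  by (rule borel_setsI) simp

lemma emeasure_ball_less_top [simp]: "emeasure M (ball x r) < top"
proof (cases "r > 0")
  case False
  then have "ball x r = {}" by (simp add: not_less)
  then have "emeasure M (ball x r) = 0" by (simp only: emeasure_empty)
  then show ?thesis by simp
qed (use ball_finite in simp)

lemma emeasure_ball: "emeasure M (ball x r) = ennreal (measure M (ball x r))"
  by (rule emeasure_eq_ennreal_measure) (metis emeasure_ball_less_top less_irrefl)

lemma emeasure_ball_neq_top [simp]: "emeasure M (ball x r) \<noteq> top"
  by (simp add: emeasure_ball)

lemma emeasure_ball_neq_0 [simp]: "r > 0 \<Longrightarrow> emeasure M (ball x r) \<noteq> 0"
  using ball_pos[of r x] by simp

lemma fmeasurable_ball [simp]: "ball x r \<in> fmeasurable M"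
  by (simp add: fmeasurable_def emeasure_ball)

lemma measure_ball_pos: "r > 0 \<Longrightarrow> 0 < measure M (ball x r)"
  using ball_pos[of r x] by (simp add: emeasure_ball)

lemma measure_ball_mono: "ball x r \<subseteq> ball y s \<Longrightarrow> measure M (ball x r) \<le> measure M (ball y s)"
  by (rule measure_mono_fmeasurable) auto

lemma emeasure_doubling:
  assumes "r > 0" "s \<ge> 1"
  shows "emeasure M (ball x (s * r)) \<le> ennreal (C * s powr n) * emeasure M (ball x r)"
  using doubling[OF assms, of x] C_ge_1
  by (simp add: emeasure_ball ennreal_mult[symmetric])

section \<open>Separated sets, nets and separability\<close>

definition separated :: "real \<Rightarrow> 'a set \<Rightarrow> bool" where
  "separated r S \<longleftrightarrow> (\<forall>x\<in>S. \<forall>y\<in>S. x \<noteq> y \<longrightarrow> r \<le> dist x y)"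

text \<open>Volume counting: the balls of radius \<open>r / 2\<close> about the points of
  \<open>S\<close> are disjoint and lie in \<open>ball x (R + r / 2)\<close>, while doubling bounds
  the measure of that ball by a fixed multiple of the measure of each of them.\<close>

lemma card_separated_le:
  assumes S: "separated r S" "S \<subseteq> ball x R" "finite S" and r: "r > 0" and R: "R > 0"
  shows "real (card S) \<le> C * (4 * R / r + 1) powr n"
proof -
  let ?K = "C * (4 * R / r + 1) powr n"
  let ?B = "ball x (R + r / 2)"
  have disj: "disjoint_family_on (\<lambda>z. ball z (r/2)) S"
    unfolding disjoint_family_on_def
  proof (intro ballI impI)
    fix y z assume "y \<in> S" "z \<in> S" "y \<noteq> z"
    then have "r \<le> dist y z" using S by (auto simp: separated_def)
    then show "ball y (r/2) \<inter> ball z (r/2) = {}"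
      by (metis disjoint_ballI field_sum_of_halves)
  qed
  have le: "measure M ?B \<le> ?K * measure M (ball z (r/2))" if "z \<in> S" for z
  proof -
    have xz: "dist x z < R" using S that by auto
    \<comment> \<open>The radius on the right is \<open>2 * R + r / 2\<close>; this is where the
      factor \<open>4 * R / r + 1\<close> comes from.\<close>
    have "ball x (R + r/2) \<subseteq> ball z ((4 * R / r + 1) * (r/2))"
    proof
      fix y assume "y \<in> ball x (R + r/2)"
      then have "dist z y < 2 * R + r/2"
        using xz dist_triangle[of z y x] by (simp add: dist_commute)
      moreover have "(4 * R / r + 1) * (r/2) = 2 * R + r/2" using r by (simp add: field_simps)
      ultimately show "y \<in> ball z ((4 * R / r + 1) * (r/2))" by simp
    qed
    then have "measure M ?B \<le> measure M (ball z ((4 * R / r + 1) * (r/2)))"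
      by (rule measure_ball_mono)
    also have "\<dots> \<le> ?K * measure M (ball z (r/2))"
      by (rule doubling) (use r R in auto)
    finally show ?thesis .
  qed
  have "real (card S) * measure M ?B \<le> (\<Sum>z\<in>S. ?K * measure M (ball z (r/2)))"
    using sum_mono[of S "\<lambda>_. measure M ?B" "\<lambda>z. ?K * measure M (ball z (r/2))"] le by simp
  also have "\<dots> = ?K * (\<Sum>z\<in>S. measure M (ball z (r/2)))"
    by (simp add: sum_distrib_left)
  also have "(\<Sum>z\<in>S. measure M (ball z (r/2))) = measure M (\<Union>z\<in>S. ball z (r/2))"
    by (rule measure_finite_Union[symmetric]) (use S(3) disj in \<open>auto simp: emeasure_ball\<close>)
  also have "\<dots> \<le> measure M ?B"
  proof (rule measure_mono_fmeasurable)
    show "(\<Union>z\<in>S. ball z (r/2)) \<subseteq> ?B"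
    proof
      fix y assume "y \<in> (\<Union>z\<in>S. ball z (r/2))"
      then obtain z where "z \<in> S" "dist z y < r/2" by auto
      then show "y \<in> ?B" using S(2) dist_triangle[of x y z] by force
    qed
  qed (use S(3) in auto)
  finally have "real (card S) * measure M ?B \<le> ?K * measure M ?B"
    using C_ge_1 by (simp add: mult_left_mono)
  moreover have "measure M ?B > 0" using r R by (intro measure_ball_pos) auto
  ultimately show ?thesis by simp
qed

lemma finite_separated:
  assumes "separated r S" "S \<subseteq> ball x R" "r > 0" "R > 0"
  shows "finite S" and "real (card S) \<le> C * (4 * R / r + 1) powr n"
proof -
  show "finite S"
  proof (rule ccontr)
    assume "infinite S"
    then obtain T where T: "T \<subseteq> S" "finite T" "card T = nat \<lceil>C * (4 * R / r + 1) powr n\<rceil> + 1"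
      using infinite_arbitrarily_large by metis
    then have "real (card T) \<le> C * (4 * R / r + 1) powr n"
      using assms by (intro card_separated_le) (auto simp: separated_def)
    with T(3) show False by linarith
  qed
  then show "real (card S) \<le> C * (4 * R / r + 1) powr n" using assms by (intro card_separated_le)
qed

text \<open>A maximal separated set, provided by Zorn's lemma, covers at scale \<open>r\<close>: a
  point missed by all the balls could be added to it. By doubling it is finite in every ball, hence
  countable.\<close>

lemma ex_net:
  assumes "r > 0"
  shows "\<exists>Z. separated r Z \<and> countable Z \<and> (\<Union>z\<in>Z. ball z r) = UNIV"
proof -
  obtain Z where Z: "separated r Z" and max: "\<And>Y. separated r Y \<Longrightarrow> Z \<subseteq> Y \<Longrightarrow> Y = Z"
  proof -
    have "\<exists>Z\<in>{Y. separated r Y}. \<forall>Y\<in>{Y. separated r Y}. Z \<subseteq> Y \<longrightarrow> Y = Z"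
    proof (rule subset_Zorn')
      fix Ch assume Ch: "subset.chain {Y. separated r Y} Ch"
      have "r \<le> dist x y" if "x \<in> \<Union>Ch" "y \<in> \<Union>Ch" "x \<noteq> y" for x y
      proof -
        obtain A B where "A \<in> Ch" "B \<in> Ch" "x \<in> A" "y \<in> B" using \<open>x \<in> \<Union>Ch\<close> \<open>y \<in> \<Union>Ch\<close> by blast
        moreover from this have "A \<subseteq> B \<or> B \<subseteq> A"
          using Ch by (auto simp: subset.chain_def)
        ultimately obtain D where "D \<in> Ch" "x \<in> D" "y \<in> D" by blast
        moreover then have "separated r D" using Ch by (auto simp: subset.chain_def)
        ultimately show ?thesis using that by (auto simp: separated_def)
      qed
      then show "\<Union>Ch \<in> {Y. separated r Y}" by (auto simp: separated_def)
    qed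
    then show ?thesis using that by blast
  qed
  have "x \<in> (\<Union>z\<in>Z. ball z r)" for x
  proof (rule ccontr)
    assume x: "x \<notin> (\<Union>z\<in>Z. ball z r)"
    then have "separated r (insert x Z)"
      using Z by (auto simp: separated_def dist_commute not_less)
    then have "insert x Z = Z" by (rule max) auto
    then have "x \<in> Z" by blast
    with x assms show False by auto
  qed
  moreover have "countable Z"
  proof -
    obtain x :: 'a where True by simp
    have "countable (Z \<inter> ball x (real (Suc i)))" for i
      by (rule countable_finite, rule finite_separated(1)[where r = r and x = x and R = "Suc i"])
        (use Z assms in \<open>auto simp: separated_def\<close>)
    then have "countable (\<Union>i. Z \<inter> ball x (real (Suc i)))" by blast
    moreover have "Z \<subseteq> (\<Union>i. Z \<inter> ball x (real (Suc i)))"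
    proof
      fix z assume "z \<in> Z"
      moreover obtain i where "dist x z < real i" using reals_Archimedean2 by blast
      ultimately show "z \<in> (\<Union>i. Z \<inter> ball x (real (Suc i)))" by (auto intro!: exI[of _ i])
    qed
    ultimately show ?thesis by (rule countable_subset[rotated])
  qed
  ultimately show ?thesis using Z by blast
qed

text \<open>Separability is not part of the type class; it comes from doubling, by uniting nets of
  radii tending to 0.\<close>

lemma ex_countable_dense:
  "\<exists>D::'a set. countable D \<and> (\<forall>x. \<forall>e>0. \<exists>d\<in>D. dist x d < e)"
proof -
  have "\<forall>i. \<exists>Z. countable Z \<and> (\<Union>z\<in>Z. ball z (1 / real (Suc i))) = (UNIV :: 'a set)"
    using ex_net by (metis of_nat_0_less_iff zero_less_Suc zero_less_divide_1_iff)
  then obtain Z :: "nat \<Rightarrow> 'a set"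
    where Z: "\<And>i. countable (Z i)" "\<And>i. (\<Union>z\<in>Z i. ball z (1 / real (Suc i))) = UNIV"
    by metis
  have "\<exists>d\<in>\<Union>i. Z i. dist x d < e" if "e > 0" for x e
  proof -
    obtain i where i: "1 / real (Suc i) < e" using \<open>e > 0\<close> nat_approx_posE by blast
    have "x \<in> (\<Union>z\<in>Z i. ball z (1 / real (Suc i)))" using Z by simp
    then show ?thesis using i by (force simp: dist_commute)
  qed
  moreover have "countable (\<Union>i. Z i)" using Z by blast
  ultimately show ?thesis by blast
qed

section \<open>Sigma-finiteness and measurability in the product\<close>

sublocale sigma_finite_measure M
proof
  obtain x :: 'a where True by simp
  show "\<exists>A. countable A \<and> A \<subseteq> sets M \<and> \<Union>A = space M \<and> (\<forall>a\<in>A. emeasure M a \<noteq> \<infinity>)"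
  proof (intro exI[of _ "range (\<lambda>i. ball x (real i))"] conjI)
    have "y \<in> (\<Union>i. ball x (real i))" for y
      using reals_Archimedean2[of "dist x y"] by auto
    then show "\<Union>(range (\<lambda>i. ball x (real i))) = space M" by auto
  qed (auto simp: emeasure_ball)
qed

text \<open>Separability enters here: the neighbourhood of the diagonal has to be a countable union
  of rectangles, namely of products of balls about a common dense point whose radii add up to
  \<open>t\<close>.\<close>

lemma dist_less_sets [measurable]: "{p. dist (fst p) (snd p) < t} \<in> sets (M \<Otimes>\<^sub>M M)"
proof -
  obtain D :: "'a set" where D: "countable D" "\<And>x e. e > 0 \<Longrightarrow> \<exists>d\<in>D. dist x d < e"
    using ex_countable_dense by blast
  have "{p::'a\<times>'a. dist (fst p) (snd p) < t} = (\<Union>d\<in>D. \<Union>q\<in>\<rat>. ball d q \<times> ball d (t - q))"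
  proof (intro equalityI subsetI)
    fix p :: "'a \<times> 'a" assume "p \<in> {p. dist (fst p) (snd p) < t}"
    then have p: "dist (fst p) (snd p) < t" by simp
    \<comment> \<open>One third of the slack: \<open>q < e\<close> leaves room for
      \<open>3 * q\<close> between \<open>dist (fst p) (snd p)\<close> and \<open>t\<close>, more
      than the two uses of \<open>q\<close> below consume.\<close>
    define e where "e = (t - dist (fst p) (snd p)) / 3"
    have "e > 0" using p by (simp add: e_def)
    then obtain d where d: "d \<in> D" "dist (fst p) d < e" using D by blast
    obtain q where q: "q \<in> \<rat>" "dist (fst p) d < q" "q < e" using Rats_dense_in_real d by blast
    have "dist d (snd p) \<le> dist (fst p) d + dist (fst p) (snd p)"
      by (metis dist_commute dist_triangle)
    moreover have "3 * q < t - dist (fst p) (snd p)" using q by (simp add: e_def)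
    ultimately have "dist d (snd p) < t - q" using q zero_le_dist[of "fst p" d] by linarith
    then have "p \<in> ball d q \<times> ball d (t - q)" using q by (cases p) (auto simp: dist_commute)
    then show "p \<in> (\<Union>d\<in>D. \<Union>q\<in>\<rat>. ball d q \<times> ball d (t - q))" using d q by blast
  next
    fix p :: "'a \<times> 'a" assume "p \<in> (\<Union>d\<in>D. \<Union>q\<in>\<rat>. ball d q \<times> ball d (t - q))"
    then obtain d q where "dist d (fst p) < q" "dist d (snd p) < t - q" by auto
    then show "p \<in> {p. dist (fst p) (snd p) < t}"
      using dist_triangle[of "fst p" "snd p" d] by (simp add: dist_commute)
  qed
  also have "\<dots> \<in> sets (M \<Otimes>\<^sub>M M)"
    using D(1) by (intro sets.countable_UN'' countable_rat pair_measureI) auto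
  finally show ?thesis .
qed

lemma ball_indicator_measurable [measurable]:
  "(\<lambda>(x, y). indicator (ball x t) y :: ennreal) \<in> borel_measurable (M \<Otimes>\<^sub>M M)"
proof -
  have "(\<lambda>p. indicator {p. dist (fst p) (snd p) < t} p :: ennreal) \<in> borel_measurable (M \<Otimes>\<^sub>M M)"
    by measurable
  also have "(\<lambda>p. indicator {p. dist (fst p) (snd p) < t} p :: ennreal) =
      (\<lambda>(x, y). indicator (ball x t) y)"
    by (auto simp: fun_eq_iff split: split_indicator)
  finally show ?thesis .
qed

lemma ball_integral_measurable:
  assumes "case_prod g \<in> borel_measurable (M \<Otimes>\<^sub>M M)"
  shows "(\<lambda>x. \<integral>\<^sup>+y\<in>ball x t. g x y \<partial>M) \<in> borel_measurable M"
proof -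
  have [measurable]: "case_prod g \<in> borel_measurable (M \<Otimes>\<^sub>M M)" by fact
  have "(\<lambda>(x, y). g x y * indicator (ball x t) y) =
      (\<lambda>p. case_prod g p * (case p of (x, y) \<Rightarrow> indicator (ball x t) y))"
    by auto
  also have "\<dots> \<in> borel_measurable (M \<Otimes>\<^sub>M M)" by measurable
  finally show ?thesis by (rule borel_measurable_nn_integral)
qed

lemma emeasure_ball_measurable [measurable]: "(\<lambda>x. emeasure M (ball x t)) \<in> borel_measurable M"
  using ball_integral_measurable[of "\<lambda>_ _. 1" t] by simp

section \<open>Partitions into pieces of comparable measure\<close>

text \<open>Points are null, so every point lies in balls of small measure. Adding countably many
  balls of measure below \<open>e\<close> one after the other makes the measure grow in steps
  smaller than \<open>e\<close>; hence pieces of measure between \<open>e\<close> and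
  \<open>2 * e\<close> can be cut off until at most \<open>3 * e\<close> is left.\<close>

lemma ex_finite_partition:
  assumes "S \<in> sets M" "emeasure M S < \<infinity>" "e > 0" "e \<le> measure M S"
  shows "\<exists>P. finite P \<and> disjoint P \<and> P \<subseteq> sets M \<and> \<Union>P = S \<and>
            (\<forall>A\<in>P. e \<le> measure M A \<and> measure M A \<le> 3 * e)"
proof -
  obtain D :: "'a set" where D: "countable D" "\<And>x e. e > 0 \<Longrightarrow> \<exists>d\<in>D. dist x d < e"
    using ex_countable_dense by blast
  \<comment> \<open>Dense centres and rational radii keep the family countable.\<close>
  define \<B> where "\<B> = {ball d q | d q. d \<in> D \<and> q \<in> \<rat> \<and> measure M (ball d q) < e}"
  have "\<B> \<subseteq> (\<lambda>(d, q). ball d q) ` (D \<times> \<rat>)" by (auto simp: \<B>_def)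
  then have cB: "countable \<B>"
    using D(1) countable_rat by (meson countable_SIGMA countable_image countable_subset)
  have cover: "\<exists>B\<in>\<B>. x \<in> B" for x
  proof -
    have "(\<lambda>i. measure M (ball x (1 / real (Suc i)))) \<longlonglongrightarrow> measure M (\<Inter>i. ball x (1 / real (Suc i)))"
    proof (rule Lim_measure_decseq)
      show "decseq (\<lambda>i. ball x (1 / real (Suc i)))"
        by (intro decseq_SucI subset_ball) (simp add: field_simps)
    qed (auto simp: emeasure_ball)
    moreover have "(\<Inter>i. ball x (1 / real (Suc i))) = {x}"
    proof -
      have "y = x" if "\<And>i. dist x y < 1 / real (Suc i)" for y
      proof (rule ccontr)
        assume "y \<noteq> x"
        then obtain i where "1 / real (Suc i) < dist x y"
          using nat_approx_posE[of "dist x y"] by auto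
        with that[of i] show False by simp
      qed
      then show ?thesis by auto
    qed
    ultimately have "(\<lambda>i. measure M (ball x (1 / real (Suc i)))) \<longlonglongrightarrow> 0"
      by (simp add: measure_def emeasure_singleton)
    from order_tendstoD(2)[OF this \<open>e > 0\<close>]
    obtain i where i: "measure M (ball x (1 / real (Suc i))) < e"
      by (auto simp: eventually_sequentially)
    define r where "r = 1 / real (Suc i)"
    have "r > 0" by (simp add: r_def)
    then obtain d where d: "d \<in> D" "dist x d < r / 2" using D(2)[of "r/2" x] by auto
    obtain q where q: "q \<in> \<rat>" "dist x d < q" "q < r / 2" using Rats_dense_in_real d by blast
    have "ball d q \<subseteq> ball x r"
    proof
      fix y assume "y \<in> ball d q"
      then show "y \<in> ball x r" using dist_triangle[of x y d] d q by simp
    qed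
    then have "measure M (ball d q) < e"
      using i measure_ball_mono[of d q x r] by (simp add: r_def)
    then have "ball d q \<in> \<B>" using d q by (auto simp: \<B>_def)
    moreover have "x \<in> ball d q" using q by (simp add: dist_commute)
    ultimately show ?thesis by blast
  qed
  then have "\<B> \<noteq> {}" by blast
  define B where "B = from_nat_into \<B>"
  have B: "range B = \<B>" unfolding B_def by (rule range_from_nat_into) fact+
  have Bm: "B i \<in> sets M" "measure M (B i) < e" "emeasure M (B i) < \<infinity>" for i
  proof -
    have "B i \<in> \<B>" unfolding B[symmetric] by (rule rangeI)
    then obtain d q where "B i = ball d q" "measure M (ball d q) < e"
      unfolding \<B>_def by blast
    then show "B i \<in> sets M" "measure M (B i) < e" "emeasure M (B i) < \<infinity>" by simp_all
  qed
  have cut: "\<exists>T\<in>sets M. T \<subseteq> U \<and> e \<le> measure M T \<and> measure M T \<le> 2 * e"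
    if U: "U \<in> sets M" "emeasure M U < \<infinity>" "e < measure M U" for U
  proof -
    define V where "V i = U \<inter> (\<Union>j<i. B j)" for i
    have V: "V i \<in> sets M" "V i \<subseteq> U" "V i \<in> fmeasurable M" for i
      using U Bm by (auto simp: V_def fmeasurable_def intro: le_less_trans[OF emeasure_mono])
    have "(\<lambda>i. measure M (V i)) \<longlonglongrightarrow> measure M (\<Union>i. V i)"
    proof (rule Lim_measure_incseq)
      show "incseq V" unfolding V_def by (intro incseq_SucI) (auto simp: lessThan_Suc)
      have "(\<Union>i. V i) \<subseteq> U" using V by blast
      then show "emeasure M (\<Union>i. V i) \<noteq> \<infinity>"
        using U emeasure_mono[of "\<Union>i. V i" U M] by (auto simp: top_unique)
    qed (use V in auto)
    moreover have "(\<Union>i. V i) = U"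
    proof -
      have "x \<in> (\<Union>i. V i)" if "x \<in> U" for x
      proof -
        obtain j where "x \<in> B j" using cover[of x] B by blast
        then have "x \<in> V (Suc j)" using that by (auto simp: V_def)
        then show ?thesis by blast
      qed
      then show ?thesis using V by blast
    qed
    ultimately have "(\<lambda>i. measure M (V i)) \<longlonglongrightarrow> measure M U" by simp
    from order_tendstoD(1)[OF this U(3)] have ex: "\<exists>i. e < measure M (V i)"
      by (auto simp: eventually_sequentially)
    \<comment> \<open>Stopping at the first union that exceeds \<open>e\<close> overshoots by less
      than one ball: the union before it has measure at most \<open>e\<close>, so this one has at
      most \<open>2 * e\<close>.\<close>
    define m where "m = (LEAST i. e < measure M (V i))"
    have m: "e < measure M (V m)" unfolding m_def by (rule LeastI_ex[OF ex])
    have "m \<noteq> 0" using m \<open>e > 0\<close> by (auto simp: V_def intro: gr0I)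
    then obtain l where l: "m = Suc l" using not0_implies_Suc by blast
    have "\<not> e < measure M (V l)" using not_less_Least[of l "\<lambda>i. e < measure M (V i)"] l by (simp add: m_def)
    moreover have "measure M (V m) \<le> measure M (V l) + measure M (B l)"
    proof -
      have Bl: "B l \<in> fmeasurable M" using Bm by (simp add: fmeasurable_def)
      have "measure M (V m) \<le> measure M (V l \<union> B l)"
        by (rule measure_mono_fmeasurable) (use V l Bl in \<open>auto simp: V_def less_Suc_eq\<close>)
      also have "\<dots> \<le> measure M (V l) + measure M (B l)"
        by (rule measure_Un_le) (use V Bm in auto)
      finally show ?thesis .
    qed
    ultimately show ?thesis using Bm[of l] m V[of m] by (intro bexI[of _ "V m"]) auto
  qed
  \<comment> \<open>Each cut removes at least \<open>e\<close>, so induction on a bound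
    \<open>i\<close> for the measure of \<open>U\<close> in units of \<open>e\<close>
    terminates.\<close>
  have "\<exists>P. finite P \<and> disjoint P \<and> P \<subseteq> sets M \<and> \<Union>P = U \<and>
            (\<forall>A\<in>P. e \<le> measure M A \<and> measure M A \<le> 3 * e)"
    if "U \<in> sets M" "emeasure M U < \<infinity>" "e \<le> measure M U" "measure M U \<le> real i * e" for U i
    using that
  proof (induction i arbitrary: U)
    case 0
    then show ?case using \<open>e > 0\<close> by simp
  next
    case (Suc i)
    show ?case
    proof (cases "measure M U \<le> 3 * e")
      case True
      then show ?thesis using Suc.prems by (intro exI[of _ "{U}"]) auto
    next
      \<comment> \<open>Removing at most \<open>2 * e\<close> from more than \<open>3 * e\<close>
        leaves more than \<open>e\<close>, as the induction hypothesis requires.\<close>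
      case False
      then obtain T where T: "T \<in> sets M" "T \<subseteq> U" "e \<le> measure M T" "measure M T \<le> 2 * e"
        using cut[of U] Suc.prems \<open>e > 0\<close> by auto
      have diff: "measure M (U - T) = measure M U - measure M T"
        by (rule measure_Diff) (use Suc.prems T in auto)
      have "\<exists>P. finite P \<and> disjoint P \<and> P \<subseteq> sets M \<and> \<Union>P = U - T \<and>
            (\<forall>A\<in>P. e \<le> measure M A \<and> measure M A \<le> 3 * e)"
      proof (rule Suc.IH)
        show "emeasure M (U - T) < \<infinity>"
          using Suc.prems T by (auto intro: le_less_trans[OF emeasure_mono])
      qed (use Suc.prems T False diff in \<open>auto simp: algebra_simps\<close>)
      then obtain P where P: "finite P" "disjoint P" "P \<subseteq> sets M" "\<Union>P = U - T"
          "\<forall>A\<in>P. e \<le> measure M A \<and> measure M A \<le> 3 * e" by auto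
      have "T \<inter> A = {}" if "A \<in> P" for A using P(4) that by blast
      then have "disjoint (insert T P)"
        using P(2) unfolding disjoint_def by (simp add: Int_commute)
      moreover have "\<Union>(insert T P) = U" using P(4) T(2) by auto
      moreover have "\<forall>A\<in>insert T P. e \<le> measure M A \<and> measure M A \<le> 3 * e"
        using P(5) T \<open>e > 0\<close> by auto
      ultimately show ?thesis using P(1,3) T(1) by (intro exI[of _ "insert T P"]) simp
    qed
  qed
  moreover obtain i where "measure M S / e \<le> real i" using real_arch_simple by blast
  then have "measure M S \<le> real i * e" using \<open>e > 0\<close> by (simp add: field_simps)
  ultimately show ?thesis using assms(1,2,4) by blast
qed

end

section \<open>Rearrangement invariant norms and averages over balls\<close>

lemma lattice_norm_eq_0_iff:
  "lattice_norm M X \<Longrightarrow> f \<in> borel_measurable M \<Longrightarrow> X f = 0 \<longleftrightarrow> (AE x in M. f x = 0)"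
  and lattice_norm_cmult:
  "lattice_norm M X \<Longrightarrow> f \<in> borel_measurable M \<Longrightarrow> 0 \<le> c \<Longrightarrow> X (\<lambda>x. ennreal c * f x) = ennreal c * X f"
  and lattice_norm_add:
  "lattice_norm M X \<Longrightarrow> f \<in> borel_measurable M \<Longrightarrow> g \<in> borel_measurable M \<Longrightarrow>
     X (\<lambda>x. f x + g x) \<le> X f + X g"
  and lattice_norm_mono:
  "lattice_norm M X \<Longrightarrow> f \<in> borel_measurable M \<Longrightarrow> g \<in> borel_measurable M \<Longrightarrow>
     (AE x in M. f x \<le> g x) \<Longrightarrow> X f \<le> X g"
  unfolding lattice_norm_def by blast+

lemma lattice_norm_sum:
  assumes X: "lattice_norm M X" and "\<And>i. i \<in> I \<Longrightarrow> f i \<in> borel_measurable M" "finite I"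
  shows "X (\<lambda>x. \<Sum>i\<in>I. f i x) \<le> (\<Sum>i\<in>I. X (f i))"
  using assms(3,2)
proof (induction rule: finite_induct)
  case empty
  then show ?case using lattice_norm_eq_0_iff[OF X, of "\<lambda>_. 0"] by simp
next
  case (insert i I)
  have "X (\<lambda>x. f i x + (\<Sum>i\<in>I. f i x)) \<le> X (f i) + X (\<lambda>x. \<Sum>i\<in>I. f i x)"
    by (rule lattice_norm_add[OF X]) (use insert in auto)
  also have "\<dots> \<le> X (f i) + (\<Sum>i\<in>I. X (f i))"
    using insert by (intro add_left_mono) auto
  finally show ?case using insert by simp
qed

lemma lattice_norm_cmult_nat:
  assumes "lattice_norm M X" "f \<in> borel_measurable M"
  shows "X (\<lambda>x. of_nat m * f x) = of_nat m * X f"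
  using lattice_norm_cmult[OF assms, of "real m"] by (simp add: ennreal_of_nat_eq_real_of_nat)

lemma banach_function_norm_fatou:
  fixes f :: "nat \<Rightarrow> 'a \<Rightarrow> ennreal"
  assumes "banach_function_norm M X" "\<And>i. f i \<in> borel_measurable M" "incseq f"
  shows "X (\<lambda>x. SUP i. f i x) = (SUP i. X (f i))"
  using assms unfolding banach_function_norm_def by blast

lemma ri_norm_lattice: "ri_norm M X \<Longrightarrow> lattice_norm M X"
  and ri_norm_banach: "ri_norm M X \<Longrightarrow> banach_function_norm M X"
  unfolding ri_norm_def banach_function_norm_def by blast+

text \<open>Smaller measures of the superlevel sets leave more admissible levels in the infimum that
  defines the rearrangement. The later arguments can thus work with distribution functions
  alone.\<close>

lemma ri_norm_distribution_mono:
  assumes X: "ri_norm M X" and "f \<in> borel_measurable M" "g \<in> borel_measurable M"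
    and le: "\<And>t. emeasure M {x \<in> space M. t < f x} \<le> emeasure M {x \<in> space M. t < g x}"
  shows "X f \<le> X g"
proof (cases "X g < \<infinity>")
  case True
  have "rearrangement M f s \<le> rearrangement M g s" for s
    unfolding rearrangement_def by (rule Inf_superset_mono) (use le order_trans in blast)
  then show ?thesis using assms True unfolding ri_norm_def by blast
qed (simp add: less_top[symmetric])

section \<open>Cyclic sums\<close>

lemma sum_add_mod:
  fixes g :: "nat \<Rightarrow> 'b::comm_monoid_add"
  assumes "N > 0"
  shows "(\<Sum>p<N. g ((p + s) mod N)) = (\<Sum>q<N. g q)"
proof (induction s arbitrary: g)
  case (Suc s)
  obtain m where m: "N = Suc m" using assms gr0_implies_Suc by blast
  have "(\<Sum>p<N. g ((p + Suc s) mod N)) = (\<Sum>p<N. g (((p + s) mod N + 1) mod N))"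
    by (simp add: mod_simps)
  also have "\<dots> = (\<Sum>q<N. g ((q + 1) mod N))"
    using Suc.IH[of "\<lambda>q. g ((q + 1) mod N)"] .
  also have "\<dots> = (\<Sum>q<m. g (Suc q)) + g 0"
    by (simp add: m)
  also have "\<dots> = (\<Sum>q<N. g q)"
    unfolding m sum.lessThan_Suc_shift by (simp add: add.commute)
  finally show ?case .
qed (auto intro!: sum.cong)

text \<open>\<open>K\<close> whole periods visit each residue \<open>K\<close> times, whatever the
  starting point \<open>p\<close>. This makes the average over all shifts the same on every piece of
  a set.\<close>

lemma sum_add_mod_mult:
  fixes g :: "nat \<Rightarrow> 'b::semiring_1"
  assumes "N > 0"
  shows "(\<Sum>s<K * N. g ((p + s) mod N)) = of_nat K * (\<Sum>q<N. g q)"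
proof -
  have "(\<Sum>s<K * N. g ((p + s) mod N)) = (\<Sum>k<K. \<Sum>s\<in>{k*N..<k*N+N}. g ((p + s) mod N))"
    by (rule sum.nat_group[symmetric])
  also have "\<dots> = (\<Sum>k<K. \<Sum>q<N. g q)"
  proof (rule sum.cong[OF refl])
    fix k
    have "(\<Sum>s\<in>{k*N..<k*N+N}. g ((p + s) mod N)) = (\<Sum>s<N. g ((p + (s + k*N)) mod N))"
      using sum.shift_bounds_nat_ivl[of "\<lambda>s. g ((p + s) mod N)" 0 "k*N" N]
      by (simp add: add.commute lessThan_atLeast0)
    also have "\<dots> = (\<Sum>s<N. g ((s + p) mod N))"
      by (rule sum.cong) (auto simp: add.assoc[symmetric] add.commute)
    also have "\<dots> = (\<Sum>q<N. g q)" by (rule sum_add_mod[OF assms])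
    finally show "(\<Sum>s\<in>{k*N..<k*N+N}. g ((p + s) mod N)) = (\<Sum>q<N. g q)" .
  qed
  finally show ?thesis by simp
qed

section \<open>Dilations, level pieces and local means\<close>

context doubling_space begin

text \<open>Take pieces of measure between \<open>e\<close> and \<open>3 * e\<close>, where
  \<open>3 * m * e\<close> is the measure of \<open>S\<close>: the upper bound makes each at most
  one \<open>m\<close>-th of \<open>S\<close>, the lower bound limits their number to
  \<open>3 * m\<close>.\<close>

lemma ex_small_cover:
  assumes S: "S \<in> sets M" "emeasure M S < \<infinity>" and m: "m \<ge> 1"
  shows "\<exists>A::nat \<Rightarrow> 'a set. (\<forall>i. A i \<in> sets M \<and> A i \<subseteq> S \<and> of_nat m * emeasure M (A i) \<le> emeasure M S)
            \<and> S = (\<Union>i<3*m. A i)"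
proof (cases "measure M S = 0")
  case True
  then have "emeasure M S = 0" using S by (simp add: measure_eq_0_null_sets[symmetric] emeasure_eq_measure2 emeasure_eq_ennreal_measure)
  \<comment> \<open>For a null set every member of the cover may be \<open>S\<close> itself;
    \<open>m \<ge> 1\<close> makes the index set nonempty.\<close>
  then show ?thesis using S m
    by (intro exI[of _ "\<lambda>_. S"]) (auto simp: lessThan_empty_iff)
next
  case False
  define e where "e = measure M S / (3 * real m)"
  have e: "e > 0" "e \<le> measure M S"
    using False m by (auto simp: e_def field_simps zero_less_measure_iff intro: order_trans)
  obtain P where P: "finite P" "disjoint P" "P \<subseteq> sets M" "\<Union>P = S"
      "\<And>A. A \<in> P \<Longrightarrow> e \<le> measure M A \<and> measure M A \<le> 3 * e"
    using ex_finite_partition[OF S e] by blast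
  have fin: "emeasure M A < \<infinity>" if "A \<in> P" for A
    using that P S emeasure_mono[of A S M] by (auto intro: le_less_trans)
  have "real (card P) * e \<le> (\<Sum>A\<in>P. measure M A)"
    using sum_mono[of P "\<lambda>_. e" "measure M"] P by simp
  also have "\<dots> = measure M (\<Union>A\<in>P. A)"
    by (rule measure_finite_Union[symmetric])
      (use P fin in \<open>auto simp: disjoint_family_on_def disjoint_def less_top[symmetric]\<close>)
  also have "\<dots> = measure M S" using P by simp
  also have "\<dots> = real (3 * m) * e" using m by (simp add: e_def)
  finally have card: "card P \<le> 3 * m" using e by simp
  obtain f where f: "bij_betw f {0..<card P} P" using ex_bij_betw_nat_finite P by blast
  \<comment> \<open>Padding with empty sets makes the number of pieces the same for all
    \<open>S\<close>, so that pieces of different level sets can later be grouped by their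
    index.\<close>
  define A where "A i = (if i < card P then f i else {})" for i
  have fP: "f i \<in> P" if "i < card P" for i using f that by (auto simp: bij_betw_def)
  have "of_nat m * emeasure M (f i) \<le> emeasure M S" if "i < card P" for i
  proof -
    have "real m * measure M (f i) \<le> measure M S"
      using P(5)[OF fP[OF that]] m by (simp add: e_def field_simps)
    then show ?thesis
      using fin[OF fP[OF that]] S
      by (simp add: emeasure_eq_ennreal_measure ennreal_of_nat_eq_real_of_nat ennreal_mult[symmetric])
  qed
  moreover have "(\<Union>i<3*m. A i) = S"
  proof -
    have "(\<Union>i<3*m. A i) = \<Union>(f ` {0..<card P})"
    proof (intro equalityI subsetI)
      fix x assume "x \<in> \<Union>(f ` {0..<card P})"
      then obtain i where "i < card P" "x \<in> f i" by auto
      then show "x \<in> (\<Union>i<3*m. A i)" using card by (intro UN_I[of i]) (auto simp: A_def)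
    qed (auto simp: A_def split: if_splits)
    then show ?thesis using f P by (simp add: bij_betw_def)
  qed
  ultimately show ?thesis
    using fP P S by (intro exI[of _ A]) (auto simp: A_def)
qed

text \<open>Takes the place of the boundedness of dilations. Choosing from each level set of
  \<open>h\<close> one piece of at most an \<open>m\<close>-th of its measure gives a restriction of
  \<open>h\<close> whose distribution function is below that of \<open>f\<close>; the
  \<open>3 * m\<close> restrictions obtained in this way add up to at least
  \<open>h\<close>.\<close>

lemma ri_norm_dilation:
  assumes X: "ri_norm M X" and h: "simple_function M h" and f: "f \<in> borel_measurable M"
    and fin: "emeasure M {x. h x \<noteq> 0} < \<infinity>" and m: "m \<ge> 1"
    and le: "\<And>t. emeasure M {x. t < h x} \<le> of_nat m * emeasure M {x. t < f x}"
  shows "X h \<le> of_nat (3 * m) * X f"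
proof -
  note [measurable] = f borel_measurable_simple_function[OF h]
  define V where "V = range h - {0}"
  define L where "L v = {x. h x = v}" for v
  have finV: "finite V" using simple_functionD(1)[OF h] by (simp add: V_def)
  have L_sets [measurable]: "L v \<in> sets M" for v
    using simple_functionD(2)[OF h, of "{v}"] by (simp add: L_def vimage_def)
  have L_fin: "emeasure M (L v) < \<infinity>" if "v \<in> V" for v
  proof -
    have "{x\<in>space M. h x \<noteq> 0} \<in> sets M" by measurable
    then have "{x. h x \<noteq> 0} \<in> sets M" by simp
    then have "emeasure M (L v) \<le> emeasure M {x. h x \<noteq> 0}"
      by (rule emeasure_mono[rotated]) (use that in \<open>auto simp: L_def V_def\<close>)
    then show ?thesis using fin by (rule le_less_trans)
  qed
  have "\<exists>A::nat \<Rightarrow> 'a set. (\<forall>i. A i \<in> sets M \<and> A i \<subseteq> L v \<and> of_nat m * emeasure M (A i) \<le> emeasure M (L v))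
            \<and> L v = (\<Union>i<3*m. A i)" if "v \<in> V" for v
    by (rule ex_small_cover) (use L_fin that m in auto)
  then obtain A :: "ennreal \<Rightarrow> nat \<Rightarrow> 'a set"
    where A: "\<And>v i. v \<in> V \<Longrightarrow> A v i \<in> sets M" "\<And>v i. v \<in> V \<Longrightarrow> A v i \<subseteq> L v"
      "\<And>v i. v \<in> V \<Longrightarrow> of_nat m * emeasure M (A v i) \<le> emeasure M (L v)"
      "\<And>v. v \<in> V \<Longrightarrow> L v = (\<Union>i<3*m. A v i)"
    by metis
  define B where "B i = (\<Union>v\<in>V. A v i)" for i
  have [measurable]: "B i \<in> sets M" for i unfolding B_def using A finV by auto
  have XB: "X (\<lambda>x. h x * indicator (B i) x) \<le> X f" for i
  proof (rule ri_norm_distribution_mono[OF X])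
    fix t
    let ?V = "{v\<in>V. t < v}"
    have "{x. t < h x * indicator (B i) x} \<subseteq> (\<Union>v\<in>?V. A v i)"
    proof
      fix x assume "x \<in> {x. t < h x * indicator (B i) x}"
      then have x: "t < h x" "x \<in> B i" by (auto split: split_indicator_asm)
      then obtain v where v: "v \<in> V" "x \<in> A v i" by (auto simp: B_def)
      then have "h x = v" using A(2) by (auto simp: L_def)
      then show "x \<in> (\<Union>v\<in>?V. A v i)" using v x by auto
    qed
    then have "emeasure M {x. t < h x * indicator (B i) x} \<le> emeasure M (\<Union>v\<in>?V. A v i)"
      by (rule emeasure_mono) (use A finV in auto)
    also have "\<dots> \<le> (\<Sum>v\<in>?V. emeasure M (A v i))"
      by (rule emeasure_subadditive_finite) (use A finV in auto)
    \<comment> \<open>Both sides carry the factor \<open>m\<close> so that the bound on the pieces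
      applies; it is cancelled at the end.\<close>
    finally have "of_nat m * emeasure M {x. t < h x * indicator (B i) x}
        \<le> of_nat m * (\<Sum>v\<in>?V. emeasure M (A v i))"
      by (rule mult_left_mono) simp
    also have "\<dots> \<le> (\<Sum>v\<in>?V. emeasure M (L v))"
      unfolding sum_distrib_left by (rule sum_mono) (use A in auto)
    also have "\<dots> = emeasure M (\<Union>v\<in>?V. L v)"
      by (rule sum_emeasure) (use finV L_sets in \<open>auto simp: disjoint_family_on_def L_def\<close>)
    also have "\<dots> \<le> emeasure M {x\<in>space M. t < h x}"
    proof (rule emeasure_mono)
      show "{x\<in>space M. t < h x} \<in> sets M" by measurable
    qed (auto simp: L_def)
    also have "{x\<in>space M. t < h x} = {x. t < h x}" by simp
    also have "emeasure M {x. t < h x} \<le> of_nat m * emeasure M {x. t < f x}" by (rule le)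
    finally show "emeasure M {x \<in> space M. t < h x * indicator (B i) x} \<le> emeasure M {x \<in> space M. t < f x}"
      using m by (simp add: ennreal_mult_le_mult_iff of_nat_less_top less_top)
  qed auto
  have "X h \<le> X (\<lambda>x. \<Sum>i<3*m. h x * indicator (B i) x)"
  proof (rule lattice_norm_mono[OF ri_norm_lattice[OF X]])
    have "h x \<le> (\<Sum>i<3*m. h x * indicator (B i) x)" for x
    proof (cases "h x = 0")
      case False
      then have "h x \<in> V" "x \<in> L (h x)" by (auto simp: V_def L_def)
      then obtain i where i: "i < 3*m" "x \<in> B i" using A(4) by (auto simp: B_def)
      have "h x * indicator (B i) x \<le> (\<Sum>i<3*m. h x * indicator (B i) x)"
        by (rule member_le_sum) (use i in auto)
      then show ?thesis using i by simp
    qed simp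
    then show "AE x in M. h x \<le> (\<Sum>i<3*m. h x * indicator (B i) x)" by simp
  qed auto
  also have "\<dots> \<le> (\<Sum>i<3*m. X (\<lambda>x. h x * indicator (B i) x))"
    by (rule lattice_norm_sum[OF ri_norm_lattice[OF X]]) auto
  also have "\<dots> \<le> (\<Sum>i<3*m. X f)"
    by (rule sum_mono) (rule XB)
  finally show ?thesis by simp
qed

text \<open>A discretization of \<open>f\<close> on \<open>S\<close> in which moving a value from
  one piece to another changes the measure of its carrier by a factor of at most 3. Covering
  \<open>S\<close> only almost everywhere allows null level sets to be dropped.\<close>

definition level_pieces ::
    "'a set \<Rightarrow> ('a \<Rightarrow> ennreal) \<Rightarrow> nat \<Rightarrow> (nat \<Rightarrow> 'a set) \<Rightarrow> (nat \<Rightarrow> ennreal) \<Rightarrow> bool" where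
  "level_pieces S f N b w \<longleftrightarrow>
     0 < N \<and> (\<forall>q<N. b q \<in> sets M \<and> b q \<subseteq> S \<and> (\<forall>x\<in>b q. f x = w q)) \<and>
     disjoint_family_on b {..<N} \<and> (AE x in M. x \<in> S \<longrightarrow> x \<in> (\<Union>q<N. b q)) \<and>
     (\<forall>q<N. \<forall>r<N. emeasure M (b q) \<le> 3 * emeasure M (b r))"

text \<open>Only finitely many level sets of \<open>f\<close> in \<open>S\<close> have positive
  measure. Each is partitioned at the same scale \<open>e\<close>, so all pieces have measure
  between \<open>e\<close> and \<open>3 * e\<close>.\<close>

lemma ex_level_pieces:
  assumes S: "S \<in> sets M" "0 < emeasure M S" "emeasure M S < \<infinity>"
    and f: "simple_function M (f :: 'a \<Rightarrow> ennreal)"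
  shows "\<exists>N b w. level_pieces S f N b w"
proof -
  note [measurable] = borel_measurable_simple_function[OF f] S(1)
  define L where "L v = {x\<in>S. f x = v}" for v
  have L_eq: "L v = S \<inter> f -` {v}" for v by (auto simp: L_def)
  have [measurable]: "L v \<in> sets M" for v
    unfolding L_eq using simple_functionD(2)[OF f, of "{v}"] S(1) by auto
  have L_fin: "emeasure M (L v) < top" for v
    using S(3) emeasure_mono[of "L v" S M] S(1) by (auto simp: L_def intro: le_less_trans)
  have finR: "finite (range f)" using simple_functionD(1)[OF f] by simp
  define V where "V = {v\<in>range f. measure M (L v) > 0}"
  have finV: "finite V" using finR by (simp add: V_def)
  have null: "L v \<in> null_sets M" if "v \<notin> V" "v \<in> range f" for v
  proof -
    have "measure M (L v) = 0" using that by (simp add: V_def zero_less_measure_iff)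
    then have "emeasure M (L v) = 0" using L_fin[of v] by (simp add: emeasure_eq_ennreal_measure)
    then show ?thesis by (simp add: null_sets_def)
  qed
  have AE: "AE x in M. x \<in> S \<longrightarrow> x \<in> (\<Union>v\<in>V. L v)"
  proof (rule AE_I')
    show "(\<Union>v\<in>range f - V. L v) \<in> null_sets M"
      using finR null by (intro null_sets.finite_UN) auto
  qed (auto simp: L_def)
  have "V \<noteq> {}"
  proof
    assume "V = {}"
    then have "AE x in M. x \<notin> S" using AE by simp
    then have "emeasure M S = 0" using S(1) by (simp add: AE_iff_measurable[OF S(1)] )
    then show False using S by simp
  qed
  \<comment> \<open>The smallest measure of a non-null level set is the largest scale at which all
    of them can be partitioned.\<close>
  define e where "e = Min ((\<lambda>v. measure M (L v)) ` V)"
  have e: "e > 0" using finV \<open>V \<noteq> {}\<close> by (auto simp: e_def V_def)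
  have eL: "e \<le> measure M (L v)" if "v \<in> V" for v
    using finV that by (auto simp: e_def)
  have "\<exists>P. finite P \<and> disjoint P \<and> P \<subseteq> sets M \<and> \<Union>P = L v \<and>
            (\<forall>A\<in>P. e \<le> measure M A \<and> measure M A \<le> 3 * e)" if "v \<in> V" for v
    by (rule ex_finite_partition) (use L_fin e eL that in auto)
  then obtain P where P: "\<And>v. v \<in> V \<Longrightarrow> finite (P v)" "\<And>v. v \<in> V \<Longrightarrow> disjoint (P v)"
     "\<And>v. v \<in> V \<Longrightarrow> P v \<subseteq> sets M" "\<And>v. v \<in> V \<Longrightarrow> \<Union>(P v) = L v"
     "\<And>v A. v \<in> V \<Longrightarrow> A \<in> P v \<Longrightarrow> e \<le> measure M A \<and> measure M A \<le> 3 * e"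
    by metis
  define Q where "Q = (\<Union>v\<in>V. P v)"
  have finQ: "finite Q" using finV P by (simp add: Q_def)
  have Q_level: "\<exists>v\<in>V. A \<in> P v \<and> A \<subseteq> L v" if "A \<in> Q" for A
    using that P(4) unfolding Q_def by blast
  have Q_sets: "A \<in> sets M" if "A \<in> Q" for A using that P(3) unfolding Q_def by blast
  have Q_disj: "A \<inter> B = {}" if AB: "A \<in> Q" "B \<in> Q" "A \<noteq> B" for A B
  proof -
    obtain v u where vu: "v \<in> V" "A \<in> P v" "A \<subseteq> L v" "u \<in> V" "B \<in> P u" "B \<subseteq> L u"
      using Q_level AB by metis
    show ?thesis
    proof (cases "u = v")
      case True
      then show ?thesis using vu P(2)[of v] AB(3) by (auto simp: disjoint_def)
    next
      case False
      then have "L u \<inter> L v = {}" by (auto simp: L_def)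
      then show ?thesis using vu by blast
    qed
  qed
  have Q_emeasure: "ennreal e \<le> emeasure M A \<and> emeasure M A \<le> 3 * ennreal e" if A: "A \<in> Q" for A
  proof -
    obtain v where v: "v \<in> V" "A \<in> P v" "A \<subseteq> L v" using Q_level[OF A] by blast
    have "emeasure M A < top"
      using emeasure_mono[OF v(3), of M] L_fin[of v] by (auto intro: le_less_trans)
    then have "emeasure M A = ennreal (measure M A)" by (simp add: emeasure_eq_ennreal_measure)
    moreover have "3 * ennreal e = ennreal (3 * e)" by (simp add: ennreal_mult')
    ultimately show ?thesis using P(5)[OF v(1,2)] by (simp add: ennreal_leI)
  qed
  obtain b where b: "bij_betw b {0..<card Q} Q" using ex_bij_betw_nat_finite finQ by blast
  have bQ: "b q \<in> Q" if "q < card Q" for q using b that by (auto simp: bij_betw_def)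
  obtain w where w: "\<And>A. A \<in> Q \<Longrightarrow> A \<subseteq> L (w A)" using Q_level by metis
  have UQ: "(\<Union>q<card Q. b q) = (\<Union>v\<in>V. L v)"
  proof -
    have "(\<Union>q<card Q. b q) = \<Union>Q" using b by (auto simp: bij_betw_def lessThan_atLeast0)
    also have "\<dots> = (\<Union>v\<in>V. \<Union>(P v))" by (auto simp: Q_def)
    also have "\<dots> = (\<Union>v\<in>V. L v)" using P(4) by simp
    finally show ?thesis .
  qed
  show ?thesis unfolding level_pieces_def
  proof (intro exI[of _ "card Q"] exI[of _ b] exI[of _ "\<lambda>q. w (b q)"] conjI allI impI)
    obtain v where "v \<in> V" using \<open>V \<noteq> {}\<close> by blast
    then have "L v \<noteq> {}" by (auto simp: V_def)
    then have "P v \<noteq> {}" using P(4)[OF \<open>v \<in> V\<close>] by auto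
    then show "0 < card Q" using \<open>v \<in> V\<close> finQ by (auto simp: card_gt_0_iff Q_def)
  next
    fix q assume "q < card Q"
    with bQ have q: "b q \<in> Q" by blast
    show "b q \<in> sets M" using q Q_sets by blast
    show "b q \<subseteq> S" "\<forall>x\<in>b q. f x = w (b q)" using w[OF q] by (auto simp: L_def)
  next
    fix q r assume "q < card Q" "r < card Q"
    then have "emeasure M (b q) \<le> 3 * ennreal e" "ennreal e \<le> emeasure M (b r)"
      using bQ Q_emeasure by blast+
    then show "emeasure M (b q) \<le> 3 * emeasure M (b r)"
      by (meson mult_left_mono order_trans zero_le)
  next
    show "disjoint_family_on b {..<card Q}"
      unfolding disjoint_family_on_def
    proof (intro ballI impI)
      fix q r assume qr: "q \<in> {..<card Q}" "r \<in> {..<card Q}" "q \<noteq> r"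
      then have "b q \<noteq> b r" using b by (auto simp: bij_betw_def inj_on_def)
      then show "b q \<inter> b r = {}" using Q_disj bQ qr by simp
    qed
  next
    show "AE x in M. x \<in> S \<longrightarrow> x \<in> (\<Union>q<card Q. b q)" using AE by (simp only: UQ)
  qed
qed

text \<open>Trades the mean of \<open>f\<close> over \<open>S\<close> for the unweighted average of
  the values \<open>w q\<close>, at the cost of the factor 3 by which the measures of the pieces may
  differ.\<close>

lemma pieces_mean_le:
  fixes f :: "'a \<Rightarrow> ennreal"
  assumes S: "S \<in> sets M" "0 < emeasure M S" "emeasure M S < \<infinity>" and f: "f \<in> borel_measurable M"
    and pieces: "level_pieces S f N b w"
  shows "of_nat N * ((\<integral>\<^sup>+x\<in>S. f x \<partial>M) / emeasure M S) \<le> 3 * (\<Sum>q<N. w q)"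
proof -
  note [measurable] = f S(1)
  have b: "\<And>q. q < N \<Longrightarrow> b q \<in> sets M \<and> b q \<subseteq> S \<and> (\<forall>x\<in>b q. f x = w q)"
    and disj: "disjoint_family_on b {..<N}" and AE: "AE x in M. x \<in> S \<longrightarrow> x \<in> (\<Union>q<N. b q)"
    and comp: "\<And>q r. q < N \<Longrightarrow> r < N \<Longrightarrow> emeasure M (b q) \<le> 3 * emeasure M (b r)"
    using pieces unfolding level_pieces_def by blast+
  have [measurable]: "b q \<in> sets M" if "q < N" for q using b that by blast
  have "(\<integral>\<^sup>+x\<in>S. f x \<partial>M) \<le> (\<integral>\<^sup>+x. (\<Sum>q<N. w q * indicator (b q) x) \<partial>M)"
  proof (rule nn_integral_mono_AE)
    show "AE x in M. f x * indicator S x \<le> (\<Sum>q<N. w q * indicator (b q) x)"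
      using AE
    proof eventually_elim
      case (elim x)
      show ?case
      proof (cases "x \<in> S")
        case True
        then obtain q where q: "q < N" "x \<in> b q" using elim by auto
        then have "(\<Sum>q<N. w q * indicator (b q) x) = w q"
          by (intro sum_indicator_disjoint_family[OF disj]) auto
        then show ?thesis using b q True by auto
      qed simp
    qed
  qed
  also have "\<dots> = (\<Sum>q<N. w q * emeasure M (b q))"
    by (subst nn_integral_sum) (auto intro!: sum.cong nn_integral_cmult_indicator)
  finally have "of_nat N * (\<integral>\<^sup>+x\<in>S. f x \<partial>M) \<le> of_nat N * (\<Sum>q<N. w q * emeasure M (b q))"
    by (rule mult_left_mono) simp
  \<comment> \<open>With the factor \<open>N\<close> written as a sum over \<open>r\<close>, each
    copy of the measure of \<open>b q\<close> can be replaced by that of another piece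
    \<open>b r\<close>; the new measures add up to at most that of \<open>S\<close>.\<close>
  also have "\<dots> = (\<Sum>q<N. w q * (\<Sum>r<N. emeasure M (b q)))"
    by (simp add: sum_distrib_left mult.left_commute)
  also have "\<dots> \<le> (\<Sum>q<N. w q * (\<Sum>r<N. 3 * emeasure M (b r)))"
    by (intro sum_mono mult_left_mono comp) auto
  also have "\<dots> = (3 * (\<Sum>q<N. w q)) * (\<Sum>r<N. emeasure M (b r))"
    by (simp add: sum_distrib_left[symmetric] sum_distrib_right[symmetric] ac_simps)
  also have "(\<Sum>r<N. emeasure M (b r)) = emeasure M (\<Union>r<N. b r)"
    by (rule sum_emeasure) (use disj in auto)
  also have "\<dots> \<le> emeasure M S"
    by (rule emeasure_mono) (use b S in auto)
  finally have "of_nat N * (\<integral>\<^sup>+x\<in>S. f x \<partial>M) \<le> (3 * (\<Sum>q<N. w q)) * emeasure M S"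
    by (simp add: mult_left_mono)
  then have "of_nat N * (\<integral>\<^sup>+x\<in>S. f x \<partial>M) / emeasure M S
      \<le> (3 * (\<Sum>q<N. w q)) * emeasure M S / emeasure M S"
    by (rule divide_right_mono_ennreal)
  then show ?thesis
    using S by (subst (asm) ennreal_mult_divide_eq) (auto simp: ennreal_times_divide)
qed

text \<open>On \<open>T i\<close> the mean over \<open>S i\<close> is, up to the factor 3, at most
  the average over \<open>s\<close> of the shifted functions \<open>h s\<close>. The distribution
  function of \<open>h s\<close> is at most \<open>3 * D\<close> times that of \<open>f\<close>: 3
  for the unequal pieces, \<open>D\<close> for the overlap. Dilation turns this into
  \<open>3 * (3 * D)\<close>, hence \<open>27 * D\<close> in total.\<close>

lemma ri_norm_local_means_simple:
  fixes f :: "'a \<Rightarrow> ennreal"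
  assumes X: "ri_norm M X" and f: "simple_function M f"
    and I: "finite I"
    and S: "\<And>i. i \<in> I \<Longrightarrow> S i \<in> sets M" "\<And>i. i \<in> I \<Longrightarrow> 0 < emeasure M (S i)"
      "\<And>i. i \<in> I \<Longrightarrow> emeasure M (S i) < \<infinity>"
    and T: "\<And>i. i \<in> I \<Longrightarrow> T i \<in> sets M" "\<And>i. i \<in> I \<Longrightarrow> T i \<subseteq> S i" "disjoint_family_on T I"
    and D: "\<And>x. card {i\<in>I. x \<in> S i} \<le> D" "D \<ge> 1"
  shows "X (\<lambda>x. \<Sum>i\<in>I. ((\<integral>\<^sup>+y\<in>S i. f y \<partial>M) / emeasure M (S i)) * indicator (T i) x)
           \<le> of_nat (27 * D) * X f"
proof -
  have fm [measurable]: "f \<in> borel_measurable M" by (rule borel_measurable_simple_function[OF f])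
  have "\<forall>i\<in>I. \<exists>N b w. level_pieces (S i) f N b w"
    by (intro ballI ex_level_pieces) (use S f in auto)
  then obtain N b w where pieces: "\<And>i. i \<in> I \<Longrightarrow> level_pieces (S i) f (N i) (b i) (w i)"
    by metis
  then have
      N: "\<And>i. i \<in> I \<Longrightarrow> 0 < N i"
    and b: "\<And>i q. i \<in> I \<Longrightarrow> q < N i \<Longrightarrow> b i q \<in> sets M \<and> b i q \<subseteq> S i \<and> (\<forall>x\<in>b i q. f x = w i q)"
    and disj: "\<And>i. i \<in> I \<Longrightarrow> disjoint_family_on (b i) {..<N i}"
    and AE: "\<And>i. i \<in> I \<Longrightarrow> AE x in M. x \<in> S i \<longrightarrow> x \<in> (\<Union>q<N i. b i q)"
    and comp: "\<And>i q r. i \<in> I \<Longrightarrow> q < N i \<Longrightarrow> r < N i \<Longrightarrow> emeasure M (b i q) \<le> 3 * emeasure M (b i r)"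
    unfolding level_pieces_def by blast+
  define J where "J = (SIGMA i:I. {..<N i})"
  \<comment> \<open>The values come from all pieces of \<open>S i\<close> but are placed on
    \<open>T i\<close> only, so that the contributions of different \<open>i\<close> have disjoint
    supports.\<close>
  define B where "B j = T (fst j) \<inter> b (fst j) (snd j)" for j
  define \<sigma> where "\<sigma> s j = w (fst j) ((snd j + s) mod N (fst j))" for s j
  define h where "h s x = (\<Sum>j\<in>J. \<sigma> s j * indicator (B j) x)" for s x
  \<comment> \<open>A common multiple of all the numbers of pieces: the shifts below
    \<open>K\<close> run through whole periods for every \<open>i\<close> simultaneously.\<close>
  define K where "K = (\<Prod>i\<in>I. N i)"
  define m where "m i = (\<integral>\<^sup>+y\<in>S i. f y \<partial>M) / emeasure M (S i)" for i
  have J: "finite J" using I by (simp add: J_def)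
  have B_sets: "B j \<in> sets M" if "j \<in> J" for j
    using that b T by (auto simp: B_def J_def)
  have B_disj: "disjoint_family_on B J"
    unfolding disjoint_family_on_def
  proof (intro ballI impI)
    fix j k assume jk: "j \<in> J" "k \<in> J" "j \<noteq> k"
    show "B j \<inter> B k = {}"
    proof (cases "fst j = fst k")
      case True
      then have "snd j \<noteq> snd k" using jk by (auto simp: prod_eq_iff)
      then have "b (fst j) (snd j) \<inter> b (fst j) (snd k) = {}"
        using jk True by (intro disjoint_family_onD[OF disj]) (auto simp: J_def)
      then show ?thesis using True by (auto simp: B_def)
    next
      case False
      then have "T (fst j) \<inter> T (fst k) = {}"
        using jk by (intro disjoint_family_onD[OF T(3)]) (auto simp: J_def)
      then show ?thesis by (auto simp: B_def)
    qed
  qed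
  have h_eq: "h s x = \<sigma> s j" if "j \<in> J" "x \<in> B j" for s x j
    unfolding h_def by (rule sum_indicator_disjoint_family[OF B_disj that(2) J that(1)])
  have h_eq0: "h s x = 0" if "x \<notin> (\<Union>j\<in>J. B j)" for s x
    unfolding h_def using that by (auto intro!: sum.neutral)
  have h_simple: "simple_function M (h s)" for s
    unfolding h_def using B_sets by (intro simple_function_sum simple_function_mult) auto
  have [measurable]: "h s \<in> borel_measurable M" for s
    by (rule borel_measurable_simple_function[OF h_simple])
  have shift: "(\<Sum>p<N i. if t < w i ((p + s) mod N i) then emeasure M (b i p) else 0)
        \<le> 3 * emeasure M (S i \<inter> {x. t < f x})" if i: "i \<in> I" for i s t
  proof -
    \<comment> \<open>The piece that receives a value is replaced by the piece that the value comes
      from, at the cost of the factor 3; then the cyclic shift is undone.\<close>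
    have "(\<Sum>p<N i. if t < w i ((p + s) mod N i) then emeasure M (b i p) else 0)
        \<le> (\<Sum>p<N i. 3 * (if t < w i ((p + s) mod N i) then emeasure M (b i ((p + s) mod N i)) else 0))"
      using comp[OF i] N[OF i] by (intro sum_mono) auto
    also have "\<dots> = (\<Sum>q<N i. 3 * (if t < w i q then emeasure M (b i q) else 0))"
      by (rule sum_add_mod[OF N[OF i]])
    also have "\<dots> = 3 * (\<Sum>q<N i. if t < w i q then emeasure M (b i q) else 0)"
      by (simp add: sum_distrib_left)
    also have "(\<Sum>q<N i. if t < w i q then emeasure M (b i q) else 0)
        = (\<Sum>q | q < N i \<and> t < w i q. emeasure M (b i q))"
      by (simp add: sum.If_cases Int_def)
    also have "\<dots> = emeasure M (\<Union>q\<in>{q. q < N i \<and> t < w i q}. b i q)"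
      by (rule sum_emeasure) (use b[OF i] disj[OF i] in \<open>auto simp: disjoint_family_on_def\<close>)
    also have "\<dots> \<le> emeasure M (S i \<inter> {x\<in>space M. t < f x})"
    proof (rule emeasure_mono)
      show "S i \<inter> {x\<in>space M. t < f x} \<in> sets M" using S(1)[OF i] by measurable
    qed (use b[OF i] in force)
    finally show ?thesis by (simp add: mult_left_mono)
  qed
  \<comment> \<open>Double counting: the number of sets \<open>S i\<close> that contain a point is
    integrated over the superlevel set.\<close>
  have overlap: "(\<Sum>i\<in>I. emeasure M (S i \<inter> {x. t < f x})) \<le> of_nat D * emeasure M {x. t < f x}" for t
  proof -
    have [measurable]: "{x. t < f x} \<in> sets M"
      using measurable_sets[OF fm, of "{t<..}"] by (simp add: vimage_def)
    have "(\<Sum>i\<in>I. emeasure M (S i \<inter> {x. t < f x}))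
        = (\<Sum>i\<in>I. \<integral>\<^sup>+x. indicator (S i) x * indicator {x. t < f x} x \<partial>M)"
      by (intro sum.cong refl) (use S in \<open>simp add: indicator_inter_arith[symmetric]\<close>)
    also have "\<dots> = (\<integral>\<^sup>+x. (\<Sum>i\<in>I. indicator (S i) x * indicator {x. t < f x} x) \<partial>M)"
      using S by (intro nn_integral_sum[symmetric]) auto
    also have "\<dots> \<le> (\<integral>\<^sup>+x. of_nat D * indicator {x. t < f x} x \<partial>M)"
    proof (rule nn_integral_mono)
      fix x
      have "(\<Sum>i\<in>I. indicator (S i) x :: ennreal) = of_nat (card {i\<in>I. x \<in> S i})"
        using I by (simp add: indicator_def sum.If_cases Int_def)
      then have "(\<Sum>i\<in>I. indicator (S i) x :: ennreal) \<le> of_nat D" using D(1)[of x] by simp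
      then show "(\<Sum>i\<in>I. indicator (S i) x * indicator {x. t < f x} x :: ennreal)
          \<le> of_nat D * indicator {x. t < f x} x"
        unfolding sum_distrib_right[symmetric] by (rule mult_right_mono) simp
    qed
    also have "\<dots> = of_nat D * emeasure M {x. t < f x}"
      by (simp add: nn_integral_cmult_indicator)
    finally show ?thesis .
  qed
  have distr: "emeasure M {x. t < h s x} \<le> of_nat (3 * D) * emeasure M {x. t < f x}" for s t
  proof -
    let ?J = "{j\<in>J. t < \<sigma> s j}"
    have "{x. t < h s x} \<subseteq> (\<Union>j\<in>?J. B j)"
    proof
      fix x assume "x \<in> {x. t < h s x}"
      then have x: "t < h s x" by simp
      then have "x \<in> (\<Union>j\<in>J. B j)" using h_eq0[of x s] by fastforce
      then obtain j where j: "j \<in> J" "x \<in> B j" by blast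
      then have "j \<in> ?J" using x h_eq[OF j] by simp
      with j show "x \<in> (\<Union>j\<in>?J. B j)" by blast
    qed
    then have "emeasure M {x. t < h s x} \<le> emeasure M (\<Union>j\<in>?J. B j)"
      by (rule emeasure_mono) (use J B_sets in auto)
    also have "\<dots> \<le> (\<Sum>j\<in>?J. emeasure M (B j))"
      by (rule emeasure_subadditive_finite) (use J B_sets in auto)
    also have "\<dots> = (\<Sum>j\<in>J. if t < \<sigma> s j then emeasure M (B j) else 0)"
      using J by (simp add: sum.If_cases Int_def)
    also have "\<dots> \<le> (\<Sum>j\<in>J. if t < \<sigma> s j then emeasure M (b (fst j) (snd j)) else 0)"
      by (intro sum_mono) (use b in \<open>auto simp: B_def J_def intro!: emeasure_mono\<close>)
    also have "\<dots> = (\<Sum>i\<in>I. \<Sum>p<N i. if t < w i ((p + s) mod N i) then emeasure M (b i p) else 0)"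
      unfolding J_def using I by (subst sum.Sigma) (auto simp: \<sigma>_def intro!: sum.cong)
    also have "\<dots> \<le> (\<Sum>i\<in>I. 3 * emeasure M (S i \<inter> {x. t < f x}))"
      by (rule sum_mono) (rule shift)
    also have "\<dots> = 3 * (\<Sum>i\<in>I. emeasure M (S i \<inter> {x. t < f x}))"
      by (simp add: sum_distrib_left)
    also have "\<dots> \<le> 3 * (of_nat D * emeasure M {x. t < f x})"
      by (rule mult_left_mono[OF overlap]) simp
    finally show ?thesis by (simp add: mult.assoc)
  qed
  have Xh: "X (h s) \<le> of_nat (3 * (3 * D)) * X f" for s
  proof (rule ri_norm_dilation[OF X h_simple fm _ _ distr])
    have "emeasure M {x. h s x \<noteq> 0} \<le> emeasure M (\<Union>i\<in>I. S i)"
    proof (rule emeasure_mono)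
      show "{x. h s x \<noteq> 0} \<subseteq> (\<Union>i\<in>I. S i)"
        using h_eq0 T(2) by (force simp: B_def J_def)
    qed (use I S in auto)
    also have "\<dots> \<le> (\<Sum>i\<in>I. emeasure M (S i))"
      by (rule emeasure_subadditive_finite) (use I S in auto)
    also have "\<dots> < \<infinity>" using I S by (simp add: ennreal_sum_less_top)
    finally show "emeasure M {x. h s x \<noteq> 0} < \<infinity>" .
  qed (use D in auto)
  have K: "K > 0" using N I by (simp add: K_def prod_pos)
  \<comment> \<open>Both sides are multiplied by \<open>K\<close>, instead of dividing the sum of
    the shifts; the factor is cancelled at the end.\<close>
  have "of_nat K * X (\<lambda>x. \<Sum>i\<in>I. m i * indicator (T i) x)
      = X (\<lambda>x. of_nat K * (\<Sum>i\<in>I. m i * indicator (T i) x))"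
    by (rule lattice_norm_cmult_nat[symmetric, OF ri_norm_lattice[OF X]]) (use T in auto)
  also have "\<dots> \<le> X (\<lambda>x. of_nat 3 * (\<Sum>s<K. h s x))"
  proof (rule lattice_norm_mono[OF ri_norm_lattice[OF X]])
    have "AE x in M. \<forall>i\<in>I. x \<in> S i \<longrightarrow> x \<in> (\<Union>q<N i. b i q)"
      using I AE by (simp add: AE_finite_all)
    then show "AE x in M. of_nat K * (\<Sum>i\<in>I. m i * indicator (T i) x) \<le> of_nat 3 * (\<Sum>s<K. h s x)"
    proof eventually_elim
      case (elim x)
      show ?case
      proof (cases "x \<in> (\<Union>i\<in>I. T i)")
        case False
        then have "(\<Sum>i\<in>I. m i * indicator (T i) x) = 0" by (auto intro!: sum.neutral)
        then show ?thesis by simp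
      next
        case True
        then obtain i where i: "i \<in> I" "x \<in> T i" by blast
        then obtain p where p: "p < N i" "x \<in> b i p" using elim T(2) by blast
        have "N i dvd K" unfolding K_def using I i by (intro dvd_prodI)
        then obtain K' where K': "K = K' * N i" by (metis dvd_def mult.commute)
        have "of_nat K * (\<Sum>i\<in>I. m i * indicator (T i) x) = of_nat K' * (of_nat (N i) * m i)"
          by (subst sum_indicator_disjoint_family[OF T(3) i(2) I i(1)]) (simp add: K' mult.assoc)
        also have "\<dots> \<le> of_nat K' * (3 * (\<Sum>q<N i. w i q))"
          unfolding m_def using S pieces i
          by (intro mult_left_mono pieces_mean_le[where b = "b i"]) auto
        \<comment> \<open>As \<open>x\<close> lies in the piece \<open>p\<close>, its values under
          the shifts are \<open>w i ((p + s) mod N i)\<close>, and \<open>s\<close> runs through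
          \<open>K'\<close> full periods.\<close>
        also have "\<dots> = 3 * (\<Sum>s<K' * N i. w i ((p + s) mod N i))"
          by (subst sum_add_mod_mult) (use N i in \<open>auto simp: ac_simps\<close>)
        also have "\<dots> = of_nat 3 * (\<Sum>s<K. h s x)"
          using i p h_eq[of "(i, p)" x] by (simp add: K' J_def B_def \<sigma>_def)
        finally show ?thesis .
      qed
    qed
  qed (use T in auto)
  also have "\<dots> = of_nat 3 * X (\<lambda>x. \<Sum>s<K. h s x)"
    by (rule lattice_norm_cmult_nat[OF ri_norm_lattice[OF X]]) auto
  also have "\<dots> \<le> of_nat 3 * (\<Sum>s<K. X (h s))"
    by (intro mult_left_mono lattice_norm_sum[OF ri_norm_lattice[OF X]]) auto
  also have "\<dots> \<le> of_nat 3 * (\<Sum>s<K. of_nat (3 * (3 * D)) * X f)"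
    by (intro mult_left_mono sum_mono Xh) auto
  also have "\<dots> = of_nat K * (of_nat (27 * D) * X f)"
    by (simp add: algebra_simps)
  finally show ?thesis
    using K unfolding m_def by (subst (asm) ennreal_mult_le_mult_iff) (auto simp: of_nat_less_top less_top)
qed

section \<open>Averages over unit balls\<close>

text \<open>A point \<open>x\<close> of the cell \<open>T z\<close> satisfies
  \<open>ball x 1 \<subseteq> ball z 2 \<subseteq> ball x 3\<close>, so the average over the moving
  ball is dominated by the mean over a fixed one. Simple functions and finitely many cells suffice
  by the Fatou property.\<close>

theorem ri_norm_ball_average:
  assumes X: "ri_norm M X"
  shows "\<exists>K. 0 \<le> K \<and> (\<forall>f\<in>borel_measurable M.
           X (\<lambda>x. (\<integral>\<^sup>+y\<in>ball x 1. f y \<partial>M) / emeasure M (ball x 1)) \<le> ennreal K * X f)"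
proof -
  obtain Z where Z: "separated 1 Z" "countable Z" "(\<Union>z\<in>Z. ball z 1) = UNIV"
    using ex_net[of 1] by auto
  \<comment> \<open>The cardinality bound for separated sets with \<open>r = 1\<close> and
    \<open>R = 2\<close>, for which \<open>4 * R / r + 1\<close> is 9.\<close>
  define D where "D = max 1 (nat \<lceil>C * 9 powr n\<rceil>)"
  have overlap: "finite {z\<in>Z. x \<in> ball z 2} \<and> card {z\<in>Z. x \<in> ball z 2} \<le> D" for x
  proof -
    have sep: "separated 1 {z\<in>Z. x \<in> ball z 2}" using Z(1) by (auto simp: separated_def)
    have sub: "{z\<in>Z. x \<in> ball z 2} \<subseteq> ball x 2" by (auto simp: dist_commute)
    have "finite {z\<in>Z. x \<in> ball z 2}" "real (card {z\<in>Z. x \<in> ball z 2}) \<le> C * 9 powr n"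
      using finite_separated[OF sep sub] by simp_all
    then show ?thesis unfolding D_def by linarith
  qed
  define idx where "idx = to_nat_on Z"
  have idx_inj: "inj_on idx Z" using Z(2) by (simp add: idx_def inj_on_to_nat_on)
  \<comment> \<open>Each point is assigned to the first ball of the enumeration that contains
    it.\<close>
  define T where "T z = ball z 1 - (\<Union>w\<in>{w\<in>Z. idx w < idx z}. ball w 1)" for z
  have T_sets [measurable]: "T z \<in> sets M" for z
    unfolding T_def using Z(2) by (intro sets.Diff sets.countable_UN'') auto
  have T_disj: "disjoint_family_on T Z"
    unfolding disjoint_family_on_def
  proof (intro ballI impI)
    fix z w assume zw: "z \<in> Z" "w \<in> Z" "z \<noteq> w"
    then have "idx z \<noteq> idx w" using idx_inj by (auto simp: inj_on_def)
    then consider "idx z < idx w" | "idx w < idx z" by linarith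
    then show "T z \<inter> T w = {}" using zw by cases (auto simp: T_def)
  qed
  have T_cover: "\<exists>z\<in>Z. x \<in> T z" for x
  proof -
    obtain z0 where "z0 \<in> Z \<and> x \<in> ball z0 1" using Z(3) by blast
    from ex_has_least_nat[of "\<lambda>z. z \<in> Z \<and> x \<in> ball z 1", OF this, of idx]
    obtain z where z: "z \<in> Z" "x \<in> ball z 1"
      and min: "\<And>w. w \<in> Z \<Longrightarrow> x \<in> ball w 1 \<Longrightarrow> idx z \<le> idx w" by blast
    have "x \<in> T z" using z min by (force simp: T_def not_less[symmetric])
    then show ?thesis using z by blast
  qed
  define I where "I m = {z\<in>Z. idx z \<le> m}" for m :: nat
  have finI: "finite (I m)" for m
  proof (rule finite_imageD)
    show "finite (idx ` I m)" by (rule finite_subset[of _ "{..m}"]) (auto simp: I_def)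
    show "inj_on idx (I m)" using idx_inj by (rule inj_on_subset) (auto simp: I_def)
  qed
  define K where "K = C * 3 powr n * real (27 * D)"
  show ?thesis
  proof (intro exI[of _ K] conjI ballI)
    show "0 \<le> K" using C_ge_1 by (simp add: K_def)
    fix f :: "'a \<Rightarrow> ennreal" assume f [measurable]: "f \<in> borel_measurable M"
    obtain F where F: "\<And>i. simple_function M (F i)" "incseq F" "\<And>i x. F i x < top"
        "\<And>x. (SUP i. F i x) = f x"
      using borel_measurable_implies_simple_function_sequence'[OF f] by blast
    have [measurable]: "F i \<in> borel_measurable M" for i
      by (rule borel_measurable_simple_function[OF F(1)])
    define \<mu> where "\<mu> g z = (\<integral>\<^sup>+y\<in>ball z 2. g y \<partial>M) / emeasure M (ball z 2)" for g z
    have \<mu>_mono: "\<mu> g z \<le> \<mu> g' z" if "\<And>x. g x \<le> g' x" for g g' z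
      unfolding \<mu>_def using that
      by (intro divide_right_mono_ennreal nn_integral_mono mult_right_mono) auto
    have \<mu>_SUP: "\<mu> f z = (SUP i. \<mu> (F i) z)" for z
    proof -
      have "(\<integral>\<^sup>+y\<in>ball z 2. f y \<partial>M) = (\<integral>\<^sup>+y. (SUP i. F i y * indicator (ball z 2) y) \<partial>M)"
        by (simp add: F(4)[symmetric] SUP_mult_right_ennreal)
      also have "\<dots> = (SUP i. \<integral>\<^sup>+y\<in>ball z 2. F i y \<partial>M)"
        using F(2) by (intro nn_integral_monotone_convergence_SUP)
          (auto simp: incseq_def le_fun_def intro: mult_right_mono)
      finally show ?thesis by (simp add: \<mu>_def SUP_divide_ennreal)
    qed
    \<comment> \<open>One index \<open>m\<close> both truncates the net and selects the simple
      approximation of \<open>f\<close>, which yields a single increasing sequence for the Fatou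
      property.\<close>
    define g where "g m x = (\<Sum>z\<in>I m. \<mu> (F m) z * indicator (T z) x)" for m x
    have [measurable]: "g m \<in> borel_measurable M" for m unfolding g_def by measurable
    have g_inc: "incseq g"
    proof (rule incseq_SucI, rule le_funI)
      fix m x
      have "g m x \<le> (\<Sum>z\<in>I m. \<mu> (F (Suc m)) z * indicator (T z) x)"
        unfolding g_def using F(2)
        by (intro sum_mono mult_right_mono \<mu>_mono) (auto simp: incseq_def le_fun_def)
      also have "\<dots> \<le> g (Suc m) x"
        unfolding g_def using finI by (intro sum_mono2) (auto simp: I_def)
      finally show "g m x \<le> g (Suc m) x" .
    qed
    have g_eq: "g m x = \<mu> (F m) z" if "z \<in> I m" "x \<in> T z" for m x z
    proof -
      have "disjoint_family_on T (I m)"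
        by (rule disjoint_family_on_mono[OF _ T_disj]) (auto simp: I_def)
      then show ?thesis unfolding g_def
        using that finI by (intro sum_indicator_disjoint_family) auto
    qed
    have Xg: "X (g m) \<le> of_nat (27 * D) * X f" for m
    proof -
      have "X (g m) \<le> of_nat (27 * D) * X (F m)"
        unfolding g_def \<mu>_def
      proof (rule ri_norm_local_means_simple[OF X F(1) finI])
        show "disjoint_family_on T (I m)"
          by (rule disjoint_family_on_mono[OF _ T_disj]) (auto simp: I_def)
        show "card {z\<in>I m. x \<in> ball z 2} \<le> D" for x
        proof -
          have "card {z\<in>I m. x \<in> ball z 2} \<le> card {z\<in>Z. x \<in> ball z 2}"
            using overlap by (intro card_mono) (auto simp: I_def)
          then show ?thesis using overlap[of x] by linarith
        qed
        show "T z \<subseteq> ball z 2" for z by (auto simp: T_def)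
      qed (auto simp: D_def ball_pos)
      also have "\<dots> \<le> of_nat (27 * D) * X f"
      proof (intro mult_left_mono lattice_norm_mono[OF ri_norm_lattice[OF X]] AE_I2)
        show "F m x \<le> f x" for x unfolding F(4)[symmetric] by (rule SUP_upper) simp
      qed auto
      finally show ?thesis .
    qed
    have "X (\<lambda>x. (\<integral>\<^sup>+y\<in>ball x 1. f y \<partial>M) / emeasure M (ball x 1))
        \<le> X (\<lambda>x. ennreal (C * 3 powr n) * (SUP m. g m x))"
    proof (intro lattice_norm_mono[OF ri_norm_lattice[OF X]] AE_I2)
      show "(\<lambda>x. (\<integral>\<^sup>+y\<in>ball x 1. f y \<partial>M) / emeasure M (ball x 1)) \<in> borel_measurable M"
        by (intro borel_measurable_divide_ennreal ball_integral_measurable) measurable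
      fix x
      obtain z where z: "z \<in> Z" "x \<in> T z" using T_cover by blast
      then have xz: "dist z x < 1" by (auto simp: T_def)
      have "(\<integral>\<^sup>+y\<in>ball x 1. f y \<partial>M) \<le> (\<integral>\<^sup>+y\<in>ball z 2. f y \<partial>M)"
      proof (rule nn_integral_mono)
        fix y
        have "dist z y < 2" if "dist x y < 1" using xz that dist_triangle[of z y x] by simp
        then show "f y * indicator (ball x 1) y \<le> f y * indicator (ball z 2) y"
          by (auto split: split_indicator)
      qed
      moreover have "emeasure M (ball z 2) \<le> ennreal (C * 3 powr n) * emeasure M (ball x 1)"
      proof -
        have "ball z 2 \<subseteq> ball x (3 * 1)"
        proof
          fix y assume "y \<in> ball z 2"
          then show "y \<in> ball x (3 * 1)"
            using xz dist_triangle[of x y z] by (simp add: dist_commute)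
        qed
        then have "emeasure M (ball z 2) \<le> emeasure M (ball x (3 * 1))"
          by (rule emeasure_mono) simp
        also have "\<dots> \<le> ennreal (C * 3 powr n) * emeasure M (ball x 1)"
          by (rule emeasure_doubling) auto
        finally show ?thesis .
      qed
      ultimately have "(\<integral>\<^sup>+y\<in>ball x 1. f y \<partial>M) / emeasure M (ball x 1)
          \<le> ennreal (C * 3 powr n) * \<mu> f z"
        unfolding \<mu>_def by (intro ennreal_divide_le_mult_divide) auto
      also have "\<mu> f z \<le> (SUP m. g m x)"
        unfolding \<mu>_SUP
      proof (rule SUP_least)
        fix m
        \<comment> \<open>The index is raised until the cell of \<open>x\<close> has entered the
          truncated sum.\<close>
        let ?m = "max m (idx z)"
        have "\<mu> (F m) z \<le> \<mu> (F ?m) z"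
          using F(2) by (intro \<mu>_mono) (auto simp: incseq_def le_fun_def)
        also have "\<dots> = g ?m x" using z by (intro g_eq[symmetric]) (auto simp: I_def)
        also have "\<dots> \<le> (SUP m. g m x)" by (rule SUP_upper) simp
        finally show "\<mu> (F m) z \<le> (SUP m. g m x)" .
      qed
      finally show "(\<integral>\<^sup>+y\<in>ball x 1. f y \<partial>M) / emeasure M (ball x 1)
          \<le> ennreal (C * 3 powr n) * (SUP m. g m x)"
        by (simp add: mult_left_mono)
    qed auto
    also have "\<dots> = ennreal (C * 3 powr n) * X (\<lambda>x. SUP m. g m x)"
      by (rule lattice_norm_cmult[OF ri_norm_lattice[OF X]]) (use C_ge_1 in auto)
    also have "X (\<lambda>x. SUP m. g m x) = (SUP m. X (g m))"
      by (rule banach_function_norm_fatou[OF ri_norm_banach[OF X] _ g_inc]) measurable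
    also have "ennreal (C * 3 powr n) * \<dots> \<le> ennreal (C * 3 powr n) * (of_nat (27 * D) * X f)"
      by (intro mult_left_mono SUP_least Xg) auto
    also have "\<dots> = ennreal K * X f"
      using C_ge_1 unfolding K_def ennreal_of_nat_eq_real_of_nat
      by (simp add: ennreal_mult mult.assoc)
    finally show "X (\<lambda>x. (\<integral>\<^sup>+y\<in>ball x 1. f y \<partial>M) / emeasure M (ball x 1)) \<le> ennreal K * X f" .
  qed
qed

end

section \<open>The modulus\<close>

context doubling_space begin

section \<open>Estimates for the modulus\<close>

lemma oscillation_measurable [measurable]:
  assumes [measurable]: "f \<in> borel_measurable M"
  shows "(\<lambda>x. \<integral>\<^sup>+y\<in>ball x t. ennreal \<bar>f x - f y\<bar> \<partial>M) \<in> borel_measurable M"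
  by (rule ball_integral_measurable) measurable

text \<open>Passing from \<open>s\<close> to \<open>t\<close>, the integral does not decrease and
  the measure of the ball grows at most by the doubling factor for ratio 2. This stands in for
  monotonicity of the modulus.\<close>

lemma modulus_doubling:
  assumes X: "lattice_norm M X" and f [measurable]: "f \<in> borel_measurable M"
    and st: "0 < s" "s \<le> t" "t \<le> 2 * s"
  shows "modulus M X f s \<le> ennreal (C * 2 powr n) * modulus M X f t"
proof -
  have "modulus M X f s
      \<le> X (\<lambda>x. ennreal (C * 2 powr n) * ((\<integral>\<^sup>+y\<in>ball x t. ennreal \<bar>f x - f y\<bar> \<partial>M) / emeasure M (ball x t)))"
    unfolding modulus_def
  proof (intro lattice_norm_mono[OF X] AE_I2)
    fix x
    have "(\<integral>\<^sup>+y\<in>ball x s. ennreal \<bar>f x - f y\<bar> \<partial>M) \<le> (\<integral>\<^sup>+y\<in>ball x t. ennreal \<bar>f x - f y\<bar> \<partial>M)"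
      using st by (intro nn_integral_mono) (auto split: split_indicator)
    moreover have "emeasure M (ball x t) \<le> ennreal (C * 2 powr n) * emeasure M (ball x s)"
    proof -
      have "emeasure M (ball x t) \<le> emeasure M (ball x (2 * s))"
        using st by (intro emeasure_mono subset_ball) auto
      also have "\<dots> \<le> ennreal (C * 2 powr n) * emeasure M (ball x s)"
        using st by (intro emeasure_doubling) auto
      finally show ?thesis .
    qed
    ultimately show "(\<integral>\<^sup>+y\<in>ball x s. ennreal \<bar>f x - f y\<bar> \<partial>M) / emeasure M (ball x s)
        \<le> ennreal (C * 2 powr n) * ((\<integral>\<^sup>+y\<in>ball x t. ennreal \<bar>f x - f y\<bar> \<partial>M) / emeasure M (ball x t))"
      using st by (intro ennreal_divide_le_mult_divide) auto
  qed measurable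
  also have "\<dots> = ennreal (C * 2 powr n) * modulus M X f t"
    unfolding modulus_def by (rule lattice_norm_cmult[OF X]) (use C_ge_1 in \<open>auto intro: order_trans\<close>)
  finally show ?thesis .
qed

text \<open>By the triangle inequality the mean oscillation at \<open>x\<close> is at most
  \<open>\<bar>f x\<bar>\<close> plus the average of \<open>\<bar>f\<bar>\<close> over the unit
  ball, and averaging is bounded on \<open>X\<close>.\<close>

lemma modulus_one_le:
  assumes X: "ri_norm M X"
  shows "\<exists>K. 0 \<le> K \<and> (\<forall>f\<in>borel_measurable M. modulus M X f 1 \<le> ennreal K * fnorm X f)"
proof -
  note lX = ri_norm_lattice[OF X]
  obtain K where K: "0 \<le> K" "\<And>f. f \<in> borel_measurable M \<Longrightarrow>
      X (\<lambda>x. (\<integral>\<^sup>+y\<in>ball x 1. f y \<partial>M) / emeasure M (ball x 1)) \<le> ennreal K * X f"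
    using ri_norm_ball_average[OF X] by blast
  have "modulus M X f 1 \<le> ennreal (1 + K) * fnorm X f" if f [measurable]: "f \<in> borel_measurable M" for f
  proof -
    let ?A = "\<lambda>x. (\<integral>\<^sup>+y\<in>ball x 1. ennreal \<bar>f y\<bar> \<partial>M) / emeasure M (ball x 1)"
    have [measurable]: "?A \<in> borel_measurable M"
      by (intro borel_measurable_divide_ennreal ball_integral_measurable) measurable
    have "modulus M X f 1 \<le> X (\<lambda>x. ennreal \<bar>f x\<bar> + ?A x)"
      unfolding modulus_def
    proof (intro lattice_norm_mono[OF lX] AE_I2)
      fix x
      have "(\<integral>\<^sup>+y\<in>ball x 1. ennreal \<bar>f x - f y\<bar> \<partial>M)
          \<le> (\<integral>\<^sup>+y. ennreal \<bar>f x\<bar> * indicator (ball x 1) y + ennreal \<bar>f y\<bar> * indicator (ball x 1) y \<partial>M)"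
        by (intro nn_integral_mono)
          (auto split: split_indicator simp: ennreal_plus[symmetric] simp del: ennreal_plus intro!: ennreal_leI)
      also have "\<dots> = ennreal \<bar>f x\<bar> * emeasure M (ball x 1) + (\<integral>\<^sup>+y\<in>ball x 1. ennreal \<bar>f y\<bar> \<partial>M)"
        by (subst nn_integral_add) (auto simp: nn_integral_cmult_indicator)
      finally have "(\<integral>\<^sup>+y\<in>ball x 1. ennreal \<bar>f x - f y\<bar> \<partial>M) / emeasure M (ball x 1)
          \<le> (ennreal \<bar>f x\<bar> * emeasure M (ball x 1) + (\<integral>\<^sup>+y\<in>ball x 1. ennreal \<bar>f y\<bar> \<partial>M)) / emeasure M (ball x 1)"
        by (rule divide_right_mono_ennreal)
      also have "\<dots> = ennreal \<bar>f x\<bar> + ?A x"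
        by (simp add: add_divide_distrib_ennreal ennreal_mult_divide_eq)
      finally show "(\<integral>\<^sup>+y\<in>ball x 1. ennreal \<bar>f x - f y\<bar> \<partial>M) / emeasure M (ball x 1)
          \<le> ennreal \<bar>f x\<bar> + ?A x" .
    qed measurable
    also have "\<dots> \<le> X (\<lambda>x. ennreal \<bar>f x\<bar>) + X ?A"
      by (rule lattice_norm_add[OF lX]) measurable
    also have "\<dots> \<le> fnorm X f + ennreal K * fnorm X f"
      unfolding fnorm_def by (intro add_left_mono K(2)) measurable
    also have "\<dots> = ennreal (1 + K) * fnorm X f"
      using K(1) by (simp add: ennreal_plus distrib_right)
    finally show ?thesis .
  qed
  then show ?thesis using K(1) by (intro exI[of _ "1 + K"]) auto
qed

section \<open>Measurability of the modulus in \<open>t\<close>\<close>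

text \<open>Since the balls are open, \<open>ball x t\<close> is the increasing union of the balls
  of radius \<open>s i\<close>, and monotone convergence applies.\<close>

lemma ball_integral_left_continuous:
  assumes [measurable]: "g \<in> borel_measurable M" and s: "incseq s" "\<And>i. s i < t" "s \<longlonglongrightarrow> t"
  shows "(\<integral>\<^sup>+y\<in>ball x t. g y \<partial>M) = (SUP i. \<integral>\<^sup>+y\<in>ball x (s i). g y \<partial>M)"
proof -
  have "(SUP i. g y * indicator (ball x (s i)) y) = g y * indicator (ball x t) y" for y
  proof (rule antisym)
    show "(SUP i. g y * indicator (ball x (s i)) y) \<le> g y * indicator (ball x t) y"
    proof (rule SUP_least)
      show "g y * indicator (ball x (s i)) y \<le> g y * indicator (ball x t) y" for i
        using s(2)[of i] by (auto split: split_indicator)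
    qed
    show "g y * indicator (ball x t) y \<le> (SUP i. g y * indicator (ball x (s i)) y)"
    proof (cases "dist x y < t")
      case True
      then obtain i where "dist x y < s i"
        using order_tendstoD(1)[OF s(3) True] by (auto simp: eventually_sequentially)
      then show ?thesis using True by (intro SUP_upper2[of i]) auto
    qed auto
  qed
  then have "(\<integral>\<^sup>+y\<in>ball x t. g y \<partial>M) = (\<integral>\<^sup>+y. (SUP i. g y * indicator (ball x (s i)) y) \<partial>M)"
    by simp
  also have "\<dots> = (SUP i. \<integral>\<^sup>+y\<in>ball x (s i). g y \<partial>M)"
  proof (rule nn_integral_monotone_convergence_SUP)
    show "incseq (\<lambda>i y. g y * indicator (ball x (s i)) y)"
      using s(1) by (auto simp: incseq_def le_fun_def split: split_indicator intro: less_le_trans)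
  qed measurable
  finally show ?thesis .
qed

text \<open>
  The modulus is neither monotone nor obviously continuous in \<open>t\<close>.  Decoupling the two radii makes
  it a countable supremum of functions that are antitone in \<open>t\<close>, by the Fatou property.
\<close>

lemma modulus_borel_measurable:
  assumes X: "banach_function_norm M X" and f [measurable]: "f \<in> borel_measurable M"
  shows "modulus M X f \<in> borel_measurable borel"
proof -
  have lX: "lattice_norm M X" using X by (simp add: banach_function_norm_def)
  define A where "A q x = (\<integral>\<^sup>+y\<in>ball x q. ennreal \<bar>f x - f y\<bar> \<partial>M)" for q x
  define G where "G q t = X (\<lambda>x. A q x / emeasure M (ball x t))" for q t
  have [measurable]: "A q \<in> borel_measurable M" for q unfolding A_def by measurable
  have A_mono: "A q x \<le> A r x" if "q \<le> r" for q r x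
    unfolding A_def using that by (intro nn_integral_mono) (auto split: split_indicator)
  have G_mono: "G q t \<le> G r t" if "q \<le> r" for q r t
    unfolding G_def
    by (intro lattice_norm_mono[OF lX] AE_I2 divide_right_mono_ennreal A_mono that) measurable
  have G_anti: "G q t \<le> G q s" if "s \<le> t" for q s t
    unfolding G_def
  proof (intro lattice_norm_mono[OF lX] AE_I2)
    fix x
    have "emeasure M (ball x s) \<le> emeasure M (ball x t)"
      using that by (intro emeasure_mono subset_ball) auto
    then show "A q x / emeasure M (ball x t) \<le> A q x / emeasure M (ball x s)"
      by (rule ennreal_divide_left_mono)
  qed measurable
  \<comment> \<open>The value 0 for \<open>t \<le> q\<close> discards the inner radii that are not
    below \<open>t\<close>. The superlevel sets remain intervals, because \<open>G q\<close> is
    antitone.\<close>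
  define H where "H q t = (if q < t then G q t else 0)" for q t
  have H_meas: "H q \<in> borel_measurable borel" for q
  proof (rule borel_measurableI_greater)
    fix a
    have "is_interval {t. a < H q t}"
      unfolding is_interval_1
    proof (intro ballI allI impI)
      fix s t u assume su: "s \<in> {t. a < H q t}" "u \<in> {t. a < H q t}" "s \<le> t \<and> t \<le> u"
      then have "q < s" "a < G q u" by (auto simp: H_def split: if_splits)
      moreover have "G q u \<le> G q t" using su by (intro G_anti) auto
      ultimately show "t \<in> {t. a < H q t}" using su by (auto simp: H_def)
    qed
    then show "{t \<in> space borel. a < H q t} \<in> sets borel"
      using real_interval_borel_measurable by simp
  qed
  have "modulus M X f t = (SUP q\<in>{q\<in>\<rat>. 0 < q}. H q t)" for t
  proof (cases "t > 0")
    case False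
    \<comment> \<open>Empty balls give the quotient \<open>0 / 0\<close>, which is 0, and every
      \<open>H q t\<close> with \<open>q > 0\<close> vanishes as well.\<close>
    then have empty: "ball x t = {}" for x :: 'a by simp
    have "modulus M X f t = X (\<lambda>_. 0)" unfolding modulus_def empty by simp
    also have "\<dots> = 0" using lattice_norm_eq_0_iff[OF lX, of "\<lambda>_. 0"] by simp
    also have "\<dots> = (SUP q\<in>{q\<in>\<rat>. 0 < q}. H q t)"
      using False by (intro SUP_eq_const[symmetric]) (auto simp: H_def intro: exI[of _ 1])
    finally show ?thesis .
  next
    case True
    \<comment> \<open>The summand 2 makes \<open>s 0\<close> equal to \<open>t / 2\<close>, so that
      all radii are positive.\<close>
    define s where "s i = t - t / (real i + 2)" for i
    have s_inc: "incseq s"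
      unfolding s_def using True by (intro incseq_SucI) (auto simp: field_simps)
    have s_pos: "0 < s i" and s_less: "s i < t" for i
      using True by (auto simp: s_def field_simps intro: add_pos_nonneg)
    have s_lim: "s \<longlonglongrightarrow> t" unfolding s_def by real_asymp
    have mod_G: "modulus M X f t = G t t" by (simp add: modulus_def G_def A_def)
    also have "\<dots> = X (\<lambda>x. SUP i. A (s i) x / emeasure M (ball x t))"
      unfolding G_def A_def
      by (subst ball_integral_left_continuous[OF _ s_inc s_less s_lim])
        (auto simp: SUP_divide_ennreal)
    also have "\<dots> = (SUP i. G (s i) t)"
      unfolding G_def
    proof (rule banach_function_norm_fatou[OF X])
      show "incseq (\<lambda>i x. A (s i) x / emeasure M (ball x t))"
        using s_inc by (auto simp: incseq_def le_fun_def intro!: divide_right_mono_ennreal A_mono)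
    qed measurable
    finally have eq: "modulus M X f t = (SUP i. G (s i) t)" .
    show ?thesis
    proof (rule antisym)
      show "modulus M X f t \<le> (SUP q\<in>{q\<in>\<rat>. 0 < q}. H q t)"
        unfolding eq
      proof (rule SUP_least)
        fix i
        \<comment> \<open>A rational between \<open>s i\<close> and \<open>t\<close> leads from a
          sequence that depends on \<open>t\<close> to an index set that does not.\<close>
        obtain q where q: "q \<in> \<rat>" "s i < q" "q < t" using Rats_dense_in_real[OF s_less] by blast
        then have "G (s i) t \<le> H q t" using G_mono[of "s i" q t] by (simp add: H_def)
        moreover have "q \<in> {q\<in>\<rat>. 0 < q}" using q s_pos[of i] by simp
        ultimately show "G (s i) t \<le> (SUP q\<in>{q\<in>\<rat>. 0 < q}. H q t)" by (rule SUP_upper2[rotated])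
      qed
      show "(SUP q\<in>{q\<in>\<rat>. 0 < q}. H q t) \<le> modulus M X f t"
        unfolding mod_G by (rule SUP_least) (auto simp: H_def intro: G_mono)
    qed
  qed
  then have "modulus M X f = (\<lambda>t. SUP q\<in>{q\<in>\<rat>. 0 < q}. H q t)" by (rule ext)
  moreover have "(\<lambda>t. SUP q\<in>{q\<in>\<rat>. 0 < q}. H q t) \<in> borel_measurable borel"
    by (rule borel_measurable_SUP) (auto intro: countable_subset[OF _ countable_rat] H_meas)
  ultimately show ?thesis by simp
qed

end

section \<open>The measure dt/t\<close>

lemma space_dt_over_t [simp]: "space dt_over_t = {0<..}"
  and sets_dt_over_t: "sets dt_over_t = sets leb_pos"
  by (simp_all add: dt_over_t_def)

lemma borel_measurable_dt_over_t: "f \<in> borel_measurable borel \<Longrightarrow> f \<in> borel_measurable dt_over_t"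
  unfolding measurable_cong_sets[OF sets_dt_over_t refl]
  by (intro measurable_restrict_space1 measurable_completion) simp

lemma Icc_sets_dt_over_t [measurable]: "0 < s \<Longrightarrow> {s..t} \<in> sets dt_over_t" for s :: real
  by (auto simp: sets_dt_over_t sets_restrict_space_iff)

lemma sigma_finite_dt_over_t: "sigma_finite_measure dt_over_t"
proof -
  have "sigma_finite_measure (lebesgue :: real measure)"
  proof
    show "\<exists>A::real set set. countable A \<and> A \<subseteq> sets lebesgue \<and> \<Union>A = space lebesgue \<and> (\<forall>a\<in>A. emeasure lebesgue a \<noteq> \<infinity>)"
    proof (intro exI[of _ "range (\<lambda>i::nat. {- real i..real i})"] conjI)
      have "x \<in> (\<Union>i::nat. {- real i..real i})" for x
      proof -
        obtain i where "\<bar>x\<bar> < real i" using reals_Archimedean2 by blast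
        then show ?thesis by (intro UN_I[of i]) auto
      qed
      then show "\<Union>(range (\<lambda>i::nat. {- real i..real i})) = space lebesgue" by auto
    qed auto
  qed
  then interpret sigma_finite_measure leb_pos
    by (rule sigma_finite_measure_restrict_space) simp
  have "(\<lambda>t. ennreal (1 / t)) \<in> borel_measurable leb_pos"
    by (intro measurable_restrict_space1 measurable_completion) measurable
  then show ?thesis unfolding dt_over_t_def by (subst sigma_finite_iff_density_finite) auto
qed

section \<open>Dyadic intervals and slowly varying weights\<close>

text \<open>The measure is \<open>ln 2\<close> for every \<open>s\<close>. The bounds, obtained from
  the values of \<open>1 / t\<close> at the two ends, are free of \<open>s\<close>, which makes the
  later estimates uniform.\<close>

lemma emeasure_dt_over_t_dyadic:
  assumes "0 < s"
  shows "1 / 2 \<le> emeasure dt_over_t {s..2 * s}" and "emeasure dt_over_t {s..2 * s} \<le> 1"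
proof -
  have m [measurable]: "(\<lambda>t. ennreal (1 / t)) \<in> borel_measurable leb_pos"
    by (intro measurable_restrict_space1 measurable_completion) measurable
  have A [measurable]: "{s..2 * s} \<in> sets leb_pos" using assms by (auto simp: sets_restrict_space_iff)
  have eq: "emeasure dt_over_t {s..2 * s} = (\<integral>\<^sup>+t. ennreal (1 / t) * indicator {s..2 * s} t \<partial>leb_pos)"
    unfolding dt_over_t_def by (rule emeasure_density[OF m A])
  have len: "emeasure leb_pos {s..2 * s} = ennreal s"
    using assms by (subst emeasure_restrict_space) auto
  have "1 / 2 = ennreal (1 / (2 * s)) * emeasure leb_pos {s..2 * s}"
    using assms unfolding len by (subst ennreal_mult[symmetric]) (auto simp: divide_ennreal_def ennreal_divide_numeral)
  also have "\<dots> = (\<integral>\<^sup>+t. ennreal (1 / (2 * s)) * indicator {s..2 * s} t \<partial>leb_pos)"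
    by (rule nn_integral_cmult_indicator[OF A, symmetric])
  also have "\<dots> \<le> (\<integral>\<^sup>+t. ennreal (1 / t) * indicator {s..2 * s} t \<partial>leb_pos)"
    using assms by (intro nn_integral_mono) (auto split: split_indicator intro!: ennreal_leI frac_le)
  finally show "1 / 2 \<le> emeasure dt_over_t {s..2 * s}" by (simp add: eq)
  have "(\<integral>\<^sup>+t. ennreal (1 / t) * indicator {s..2 * s} t \<partial>leb_pos)
      \<le> (\<integral>\<^sup>+t. ennreal (1 / s) * indicator {s..2 * s} t \<partial>leb_pos)"
    using assms by (intro nn_integral_mono) (auto split: split_indicator intro!: ennreal_leI frac_le)
  also have "\<dots> = ennreal (1 / s) * emeasure leb_pos {s..2 * s}"
    by (rule nn_integral_cmult_indicator[OF A])
  also have "\<dots> = 1" using assms unfolding len by (subst ennreal_mult[symmetric]) auto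
  finally show "emeasure dt_over_t {s..2 * s} \<le> 1" by (simp add: eq)
qed

text \<open>The weight is the product of \<open>t powr \<epsilon> * b t\<close>, which is equivalent
  to an increasing function, and the power \<open>t powr (-(\<epsilon> + \<theta>))\<close>, which
  changes by a bounded factor on \<open>[s, 2s]\<close>.\<close>

lemma slowly_varying_weight:
  assumes "slowly_varying b"
  shows "\<exists>K>0. \<forall>s t. 0 < s \<longrightarrow> s \<le> t \<longrightarrow> t \<le> 2 * s \<longrightarrow>
           s powr (-\<theta>) * b s \<le> K * (t powr (-\<theta>) * b t)"
proof -
  have pos: "b t > 0" if "t > 0" for t using assms that by (auto simp: slowly_varying_def)
  \<comment> \<open>This choice makes both \<open>\<epsilon>\<close> and
    \<open>\<epsilon> + \<theta>\<close> positive for either sign of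
    \<open>\<theta>\<close>.\<close>
  define \<epsilon> where "\<epsilon> = \<bar>\<theta>\<bar> + 1"
  have \<epsilon>: "\<epsilon> > 0" by (simp add: \<epsilon>_def)
  obtain g where g: "mono_on {0<..} g" "equivalent_on_pos (\<lambda>t. t powr \<epsilon> * b t) g"
    using assms \<epsilon> unfolding slowly_varying_def by blast
  then obtain c1 c2 where c: "c1 > 0" "c2 > 0"
    and le: "\<And>t. t > 0 \<Longrightarrow> c1 * g t \<le> t powr \<epsilon> * b t \<and> t powr \<epsilon> * b t \<le> c2 * g t"
    unfolding equivalent_on_pos_def by blast
  define K where "K = c2 / c1 * 2 powr (\<epsilon> + \<theta>)"
  have "s powr (-\<theta>) * b s \<le> K * (t powr (-\<theta>) * b t)" if st: "0 < s" "s \<le> t" "t \<le> 2 * s" for s t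
  proof -
    have "s powr \<epsilon> * b s \<le> c2 * g s" using le st by simp
    also have "\<dots> \<le> c2 * g t"
      using st c by (intro mult_left_mono mono_onD[OF g(1)]) auto
    also have "\<dots> = c2 / c1 * (c1 * g t)" using c by simp
    also have "\<dots> \<le> c2 / c1 * (t powr \<epsilon> * b t)" using le[of t] st c by (intro mult_left_mono) auto
    finally have 1: "s powr \<epsilon> * b s \<le> c2 / c1 * (t powr \<epsilon> * b t)" .
    have "s powr (-\<theta>) * b s = s powr (-(\<epsilon> + \<theta>)) * (s powr \<epsilon> * b s)"
      by (simp add: mult.assoc[symmetric] powr_add[symmetric])
    also have "\<dots> \<le> s powr (-(\<epsilon> + \<theta>)) * (c2 / c1 * (t powr \<epsilon> * b t))"
      using 1 by (rule mult_left_mono) simp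
    also have "\<dots> \<le> (2 powr (\<epsilon> + \<theta>) * t powr (-(\<epsilon> + \<theta>))) * (c2 / c1 * (t powr \<epsilon> * b t))"
    proof (rule mult_right_mono)
      have "t powr (\<epsilon> + \<theta>) \<le> (2 * s) powr (\<epsilon> + \<theta>)" using st by (intro powr_mono2) (auto simp: \<epsilon>_def)
      also have "\<dots> = 2 powr (\<epsilon> + \<theta>) * s powr (\<epsilon> + \<theta>)" using st by (simp add: powr_mult)
      finally show "s powr (-(\<epsilon> + \<theta>)) \<le> 2 powr (\<epsilon> + \<theta>) * t powr (-(\<epsilon> + \<theta>))"
        using st by (simp add: powr_minus field_simps del: minus_add_distrib)
      show "0 \<le> c2 / c1 * (t powr \<epsilon> * b t)" using c pos[of t] st by simp
    qed
    also have "\<dots> = K * (t powr (-\<theta>) * b t)"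
    proof -
      have "t powr (-\<theta>) = t powr (-(\<epsilon> + \<theta>)) * t powr \<epsilon>" by (simp add: powr_add[symmetric])
      then show ?thesis by (simp only: K_def ac_simps)
    qed
    finally show ?thesis .
  qed
  moreover have "K > 0" using c by (simp add: K_def)
  ultimately show ?thesis by blast
qed

text \<open>The constant \<open>v\<close> is integrated over a set of measure at least 1/2.\<close>

lemma le_L1_norm_dyadic:
  assumes [measurable]: "\<psi> \<in> borel_measurable dt_over_t" and s: "0 < s"
    and K: "0 \<le> K" and le: "\<And>t. t \<in> {s..2 * s} \<Longrightarrow> v \<le> ennreal K * \<psi> t"
  shows "v \<le> ennreal (2 * K) * L1_norm dt_over_t \<psi>"
proof -
  have [measurable]: "{s..2 * s} \<in> sets dt_over_t" using s by measurable
  have "v = v * (2 * (1 / 2))" by (simp add: ennreal_times_divide)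
  also have "\<dots> \<le> v * (2 * emeasure dt_over_t {s..2 * s})"
    by (intro mult_left_mono emeasure_dt_over_t_dyadic s) auto
  also have "\<dots> = 2 * (\<integral>\<^sup>+t. v * indicator {s..2 * s} t \<partial>dt_over_t)"
    by (simp add: nn_integral_cmult_indicator mult.left_commute)
  also have "\<dots> \<le> 2 * (\<integral>\<^sup>+t. ennreal K * \<psi> t \<partial>dt_over_t)"
    using le by (intro mult_left_mono nn_integral_mono) (auto split: split_indicator)
  also have "\<dots> = 2 * (ennreal K * L1_norm dt_over_t \<psi>)"
    by (simp add: nn_integral_cmult L1_norm_def)
  also have "\<dots> = ennreal (2 * K) * L1_norm dt_over_t \<psi>"
    using K by (simp add: ennreal_mult mult.assoc)
  finally show ?thesis .
qed

lemma Linf_norm_dt_over_t_le: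
  assumes "\<psi> \<in> borel_measurable dt_over_t" "\<And>s. s > 0 \<Longrightarrow> \<psi> s \<le> v"
  shows "Linf_norm dt_over_t \<psi> \<le> v"
  unfolding Linf_norm_def by (rule esssup_I[OF assms(1) AE_I2]) (use assms(2) in auto)

section \<open>The interpolation space between intersection and sum\<close>

text \<open>The functor is bounded by the larger endpoint norm on real-valued functions. A function
  of finite essential supremum agrees almost everywhere with a real-valued one, and an infinite
  right-hand side makes the claim trivial.\<close>

lemma tilde_le_L1_Linf:
  assumes F: "exact_interpolation_functor F"
  shows "\<exists>C>0. \<forall>\<psi>\<in>borel_measurable dt_over_t.
           tilde F \<psi> \<le> ennreal C * (L1_norm dt_over_t \<psi> + Linf_norm dt_over_t \<psi>)"
proof -
  let ?\<nu> = dt_over_t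
  have lF: "lattice_norm ?\<nu> (F ?\<nu>)"
    using F sigma_finite_dt_over_t unfolding exact_interpolation_functor_def by blast
  obtain C where C: "C > 0" "\<And>f. f \<in> fspace ?\<nu> (L1_norm ?\<nu>) \<inter> fspace ?\<nu> (Linf_norm ?\<nu>) \<Longrightarrow>
      fnorm (F ?\<nu>) f \<le> ennreal C * max (fnorm (L1_norm ?\<nu>) f) (fnorm (Linf_norm ?\<nu>) f)"
    using F sigma_finite_dt_over_t unfolding exact_interpolation_functor_def by blast
  have "tilde F \<psi> \<le> ennreal C * (L1_norm ?\<nu> \<psi> + Linf_norm ?\<nu> \<psi>)"
    if \<psi> [measurable]: "\<psi> \<in> borel_measurable ?\<nu>" for \<psi>
  proof (cases "L1_norm ?\<nu> \<psi> + Linf_norm ?\<nu> \<psi> = top")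
    case True
    show ?thesis unfolding True using C(1) by (simp add: ennreal_mult_top)
  next
    case False
    define f where "f t = enn2real (\<psi> t)" for t
    have [measurable]: "f \<in> borel_measurable ?\<nu>" unfolding f_def by measurable
    have "Linf_norm ?\<nu> \<psi> < top" using False by (auto simp: less_top)
    then have eq: "AE t in ?\<nu>. ennreal \<bar>f t\<bar> = \<psi> t"
      using esssup_AE[of \<psi> ?\<nu>] unfolding Linf_norm_def
      by (auto elim!: eventually_mono simp: f_def intro!: ennreal_enn2real dest: le_less_trans)
    have L1: "fnorm (L1_norm ?\<nu>) f = L1_norm ?\<nu> \<psi>"
      unfolding fnorm_def L1_norm_def by (rule nn_integral_cong_AE[OF eq])
    have Linf: "fnorm (Linf_norm ?\<nu>) f = Linf_norm ?\<nu> \<psi>"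
      unfolding fnorm_def Linf_norm_def by (rule esssup_AE_cong[OF _ _ eq]) measurable
    have "tilde F \<psi> \<le> fnorm (F ?\<nu>) f"
      unfolding tilde_def fnorm_def
      by (rule lattice_norm_mono[OF lF]) (use eq in auto)
    also have "\<dots> \<le> ennreal C * max (L1_norm ?\<nu> \<psi>) (Linf_norm ?\<nu> \<psi>)"
      using C(2)[of f] False by (auto simp: fspace_def L1 Linf less_top)
    also have "\<dots> \<le> ennreal C * (L1_norm ?\<nu> \<psi> + Linf_norm ?\<nu> \<psi>)"
      by (intro mult_left_mono) auto
    finally show ?thesis .
  qed
  then show ?thesis using C(1) by blast
qed

text \<open>For any splitting \<open>g + h\<close> of the indicator, integration over the interval
  gives at least 1/2. The part of \<open>g\<close> is bounded by its \<open>L\<^sup>1\<close> norm,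
  that of \<open>h\<close> by its essential supremum, as the interval has measure at most 1.\<close>

lemma half_le_L1_plus_Linf_norm:
  assumes s: "0 < s"
  shows "1 / 2 \<le> L1_plus_Linf_norm dt_over_t (indicator {s..2 * s})"
  unfolding L1_plus_Linf_norm_def
proof (rule Inf_greatest, clarify)
  let ?A = "{s..2 * s}"
  fix g h :: "real \<Rightarrow> real"
  assume [measurable]: "g \<in> borel_measurable dt_over_t" "h \<in> borel_measurable dt_over_t"
    and AE: "AE x in dt_over_t. indicator ?A x = g x + h x"
  have [measurable]: "?A \<in> sets dt_over_t" using s by measurable
  let ?H = "fnorm (Linf_norm dt_over_t) h"
  have H: "AE t in dt_over_t. ennreal \<bar>h t\<bar> \<le> ?H"
    unfolding fnorm_def Linf_norm_def by (rule esssup_AE)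
  have "1 / 2 \<le> emeasure dt_over_t ?A" by (rule emeasure_dt_over_t_dyadic[OF s])
  also have "\<dots> = (\<integral>\<^sup>+t. indicator ?A t \<partial>dt_over_t)" by simp
  also have "\<dots> \<le> (\<integral>\<^sup>+t. ennreal \<bar>g t\<bar> + ?H * indicator ?A t \<partial>dt_over_t)"
    using AE H
  proof (intro nn_integral_mono_AE, eventually_elim)
    case (elim t)
    show ?case
    proof (cases "t \<in> ?A")
      case True
      then have "1 \<le> \<bar>g t\<bar> + \<bar>h t\<bar>" using elim by simp
      then have "1 \<le> ennreal \<bar>g t\<bar> + ennreal \<bar>h t\<bar>"
        by (simp add: ennreal_plus[symmetric] del: ennreal_plus)
      also have "\<dots> \<le> ennreal \<bar>g t\<bar> + ?H" by (intro add_left_mono elim)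
      finally show ?thesis using True by simp
    qed simp
  qed
  also have "\<dots> = fnorm (L1_norm dt_over_t) g + ?H * emeasure dt_over_t ?A"
    by (subst nn_integral_add) (auto simp: nn_integral_cmult_indicator fnorm_def L1_norm_def)
  also have "\<dots> \<le> fnorm (L1_norm dt_over_t) g + ?H * 1"
    by (intro add_left_mono mult_left_mono emeasure_dt_over_t_dyadic s) auto
  finally show "1 / 2 \<le> fnorm (L1_norm dt_over_t) g + ?H" by simp
qed

text \<open>The indicator of the interval times \<open>v\<close> lies below
  \<open>ennreal K * \<psi>\<close>, and the embedding into the sum space bounds the norm of the
  indicator from below, uniformly in \<open>s\<close>.\<close>

lemma le_tilde_dyadic:
  assumes F: "exact_interpolation_functor F"
  shows "\<exists>C>0. \<forall>\<psi>\<in>borel_measurable dt_over_t. \<forall>s>0. \<forall>K\<ge>0. \<forall>v.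
           (\<forall>t\<in>{s..2 * s}. v \<le> ennreal K * \<psi> t) \<longrightarrow> v \<le> ennreal (C * K) * tilde F \<psi>"
proof -
  let ?\<nu> = dt_over_t
  have lF: "lattice_norm ?\<nu> (F ?\<nu>)"
    using F sigma_finite_dt_over_t unfolding exact_interpolation_functor_def by blast
  obtain C where C: "C > 0" "\<And>f. f \<in> fspace ?\<nu> (F ?\<nu>) \<Longrightarrow> L1_plus_Linf_norm ?\<nu> f \<le> ennreal C * fnorm (F ?\<nu>) f"
    using F sigma_finite_dt_over_t unfolding exact_interpolation_functor_def by blast
  have "v \<le> ennreal (2 * C * K) * tilde F \<psi>"
    if \<psi> [measurable]: "\<psi> \<in> borel_measurable ?\<nu>" and s: "s > 0" and K: "K \<ge> 0"
      and le: "\<And>t. t \<in> {s..2 * s} \<Longrightarrow> v \<le> ennreal K * \<psi> t" for \<psi> s K v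
  proof -
    define A where "A = {s..2 * s}"
    have [measurable]: "A \<in> sets ?\<nu>" unfolding A_def using s by measurable
    let ?F1 = "F ?\<nu> (indicator A)"
    have fn: "fnorm (F ?\<nu>) (indicator A) = ?F1"
      unfolding fnorm_def by (rule arg_cong[where f = "F ?\<nu>"]) (auto split: split_indicator)
    have "1 / 2 \<le> ennreal C * ?F1"
    \<comment> \<open>The embedding speaks of elements of the space only, that is, of an indicator
      of finite norm; an infinite norm satisfies the bound anyway.\<close>
    proof (cases "?F1 = top")
      case True
      then show ?thesis using C(1) by (simp add: ennreal_mult_top)
    next
      case False
      then have ind: "indicator A \<in> fspace ?\<nu> (F ?\<nu>)" by (simp add: fspace_def fn less_top)
      have "1 / 2 \<le> L1_plus_Linf_norm ?\<nu> (indicator A)"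
        unfolding A_def by (rule half_le_L1_plus_Linf_norm[OF s])
      also have "\<dots> \<le> ennreal C * ?F1" using C(2)[OF ind] by (simp only: fn)
      finally show ?thesis .
    qed
    then have "2 * (1 / 2) \<le> 2 * (ennreal C * ?F1)" by (rule mult_left_mono) simp
    then have one: "1 \<le> ennreal (2 * C) * ?F1"
      using C(1) by (simp add: ennreal_mult mult.assoc ennreal_times_divide)
    \<comment> \<open>Homogeneity is available for real factors, so a possibly infinite
      \<open>v\<close> is approached by real numbers from below.\<close>
    have real_le: "ennreal c \<le> ennreal (2 * C * K) * tilde F \<psi>" if c: "0 \<le> c" "ennreal c \<le> v" for c
    proof -
      have "ennreal c * 1 \<le> ennreal c * (ennreal (2 * C) * ?F1)"
        by (intro mult_left_mono one) simp
      also have "\<dots> = ennreal (2 * C) * F ?\<nu> (\<lambda>t. ennreal c * indicator A t)"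
        by (subst lattice_norm_cmult[OF lF]) (use c in \<open>auto simp: ac_simps\<close>)
      also have "\<dots> \<le> ennreal (2 * C) * F ?\<nu> (\<lambda>t. ennreal K * \<psi> t)"
      proof (intro mult_left_mono lattice_norm_mono[OF lF] AE_I2)
        show "ennreal c * indicator A t \<le> ennreal K * \<psi> t" for t
          using le[of t] c(2) by (cases "t \<in> A") (auto simp: A_def intro: order_trans)
      qed measurable
      also have "\<dots> = ennreal (2 * C) * (ennreal K * tilde F \<psi>)"
        using lattice_norm_cmult[OF lF \<psi> K] by (simp add: tilde_def)
      also have "\<dots> = ennreal (2 * C * K) * tilde F \<psi>"
        using C(1) K by (simp add: ennreal_mult mult.assoc)
      finally show ?thesis by simp
    qed
    show ?thesis
    proof (rule dense_le)
      fix x assume x: "x < v"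
      then obtain c where "0 \<le> c" "x = ennreal c" by (cases x) auto
      then show "x \<le> ennreal (2 * C * K) * tilde F \<psi>" using real_le[of c] x by simp
    qed
  qed
  then show ?thesis using C(1) by (intro exI[of _ "2 * C"]) auto
qed

section \<open>Embeddings\<close>

lemma RD_space_doubling_space:
  assumes "RD_space M k n"
  shows "\<exists>C. doubling_space M C n"
proof -
  obtain C where "1 \<le> C" "\<And>x r s. r > 0 \<Longrightarrow> s \<ge> 1 \<Longrightarrow>
      measure M (ball x (s * r)) \<le> C * s powr n * measure M (ball x r)"
    using assms unfolding RD_space_def by blast
  moreover have "metric_measure_space M" using assms by (simp add: RD_space_def)
  ultimately have "doubling_space M C n"
    by unfold_locales (auto simp: metric_measure_space_def)
  then show ?thesis by blast
qed

lemma L1_plus_Linf_measurable: "f \<in> L1_plus_Linf M \<Longrightarrow> f \<in> borel_measurable M"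
  by (auto simp: L1_plus_Linf_def fspace_def)

text \<open>
  In the next two lemmas, the second alternative of the hypothesis accounts for the cut-off at 1 in
  the inhomogeneous norm: for \<open>s\<close> in \<open>[1/2, 1)\<close>, the interval \<open>[s, 2s]\<close> leaves \<open>(0, 1)\<close>.
\<close>

lemma tilde_le_L1_norm:
  assumes F: "exact_interpolation_functor F" and K: "0 \<le> K"
  shows "\<exists>C>0. \<forall>\<psi>\<in>borel_measurable dt_over_t. \<forall>R.
           (\<forall>s>0. (\<forall>t\<in>{s..2 * s}. \<psi> s \<le> ennreal K * \<psi> t) \<or> \<psi> s \<le> R) \<longrightarrow>
           tilde F \<psi> \<le> ennreal C * (tilde L1_norm \<psi> + R)"
proof -
  obtain C where C: "C > 0" and le: "\<And>\<psi>. \<psi> \<in> borel_measurable dt_over_t \<Longrightarrow>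
      tilde F \<psi> \<le> ennreal C * (L1_norm dt_over_t \<psi> + Linf_norm dt_over_t \<psi>)"
    using tilde_le_L1_Linf[OF F] by blast
  have "tilde F \<psi> \<le> ennreal (C * (1 + 2 * K)) * (tilde L1_norm \<psi> + R)"
    if \<psi>: "\<psi> \<in> borel_measurable dt_over_t"
      and alt: "\<And>s. s > 0 \<Longrightarrow> (\<forall>t\<in>{s..2 * s}. \<psi> s \<le> ennreal K * \<psi> t) \<or> \<psi> s \<le> R" for \<psi> R
  proof -
    let ?L = "L1_norm dt_over_t \<psi>"
    have "Linf_norm dt_over_t \<psi> \<le> ennreal (2 * K) * ?L + R"
    proof (rule Linf_norm_dt_over_t_le[OF \<psi>])
      fix s :: real assume s: "s > 0"
      from alt[OF s] show "\<psi> s \<le> ennreal (2 * K) * ?L + R"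
      proof
        assume "\<forall>t\<in>{s..2 * s}. \<psi> s \<le> ennreal K * \<psi> t"
        then have "\<psi> s \<le> ennreal (2 * K) * ?L" using le_L1_norm_dyadic[OF \<psi> s K] by blast
        then show ?thesis by (rule order_trans) simp
      next
        assume "\<psi> s \<le> R"
        then show ?thesis by (rule order_trans) simp
      qed
    qed
    then have "tilde F \<psi> \<le> ennreal C * (?L + (ennreal (2 * K) * ?L + R))"
      by (intro order_trans[OF le[OF \<psi>]] mult_left_mono add_left_mono) auto
    also have "?L + (ennreal (2 * K) * ?L + R) \<le> ennreal (1 + 2 * K) * (?L + R)"
    proof -
      have "R \<le> ennreal (1 + 2 * K) * R"
        using K mult_right_mono[of 1 "ennreal (1 + 2 * K)" R] by simp
      then show ?thesis using K by (simp add: distrib_left distrib_right add.assoc add_left_mono)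
    qed
    finally show ?thesis
      using C K by (simp add: ennreal_mult mult.assoc mult_left_mono tilde_def)
  qed
  then show ?thesis using C K by (intro exI[of _ "C * (1 + 2 * K)"]) auto
qed

lemma Linf_norm_le_tilde:
  assumes F: "exact_interpolation_functor F" and K: "0 \<le> K"
  shows "\<exists>C>0. \<forall>\<psi>\<in>borel_measurable dt_over_t. \<forall>R.
           (\<forall>s>0. (\<forall>t\<in>{s..2 * s}. \<psi> s \<le> ennreal K * \<psi> t) \<or> \<psi> s \<le> R) \<longrightarrow>
           tilde Linf_norm \<psi> \<le> ennreal C * (tilde F \<psi> + R)"
proof -
  obtain C where C: "C > 0" and le: "\<And>\<psi> s v. \<psi> \<in> borel_measurable dt_over_t \<Longrightarrow> s > 0 \<Longrightarrow>
      \<forall>t\<in>{s..2 * s}. v \<le> ennreal K * \<psi> t \<Longrightarrow> v \<le> ennreal (C * K) * tilde F \<psi>"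
    using le_tilde_dyadic[OF F] K by blast
  have "tilde Linf_norm \<psi> \<le> ennreal (1 + C * K) * (tilde F \<psi> + R)"
    if \<psi>: "\<psi> \<in> borel_measurable dt_over_t"
      and alt: "\<And>s. s > 0 \<Longrightarrow> (\<forall>t\<in>{s..2 * s}. \<psi> s \<le> ennreal K * \<psi> t) \<or> \<psi> s \<le> R" for \<psi> R
    unfolding tilde_def[of Linf_norm]
  proof (rule Linf_norm_dt_over_t_le[OF \<psi>])
    fix s :: real assume s: "s > 0"
    from alt[OF s] show "\<psi> s \<le> ennreal (1 + C * K) * (tilde F \<psi> + R)"
    proof
      assume "\<forall>t\<in>{s..2 * s}. \<psi> s \<le> ennreal K * \<psi> t"
      then have "\<psi> s \<le> ennreal (C * K) * tilde F \<psi>" by (rule le[OF \<psi> s])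
      also have "\<dots> \<le> ennreal (1 + C * K) * (tilde F \<psi> + R)"
        using C K by (intro mult_mono) (auto intro!: ennreal_leI)
      finally show ?thesis .
    next
      assume "\<psi> s \<le> R"
      also have "R = 1 * R" by simp
      also have "\<dots> \<le> ennreal (1 + C * K) * (tilde F \<psi> + R)"
        using C K by (intro mult_mono) auto
      finally show ?thesis .
    qed
  qed
  then show ?thesis using C K by (intro exI[of _ "1 + C * K"]) (auto simp: add_pos_nonneg)
qed

context doubling_space begin

section \<open>The two chains of Besov spaces\<close>

lemma besov_integrand_measurable:
  assumes "ri_norm M X" "slowly_varying b" "f \<in> borel_measurable M"
  shows "(\<lambda>t. ennreal (t powr (-\<theta>) * b t) * modulus M X f t) \<in> borel_measurable dt_over_t"
proof -
  have "modulus M X f \<in> borel_measurable dt_over_t"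
    using assms by (intro borel_measurable_dt_over_t modulus_borel_measurable ri_norm_banach)
  moreover have "b \<in> borel_measurable dt_over_t"
    using assms unfolding slowly_varying_def measurable_cong_sets[OF sets_dt_over_t refl] by blast
  moreover have "(\<lambda>t. t powr (-\<theta>)) \<in> borel_measurable dt_over_t"
    by (rule borel_measurable_dt_over_t) measurable
  ultimately show ?thesis by measurable
qed

text \<open>Slow variation controls the weight and doubling controls the modulus; neither constant
  depends on \<open>f\<close>.\<close>

lemma besov_integrand_doubling:
  assumes X: "ri_norm M X" and b: "slowly_varying b"
  shows "\<exists>K>0. \<forall>f\<in>borel_measurable M. \<forall>s t. 0 < s \<longrightarrow> s \<le> t \<longrightarrow> t \<le> 2 * s \<longrightarrow>
           ennreal (s powr (-\<theta>) * b s) * modulus M X f s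
             \<le> ennreal K * (ennreal (t powr (-\<theta>) * b t) * modulus M X f t)"
proof -
  obtain K where K: "K > 0" "\<And>s t. 0 < s \<Longrightarrow> s \<le> t \<Longrightarrow> t \<le> 2 * s \<Longrightarrow>
           s powr (-\<theta>) * b s \<le> K * (t powr (-\<theta>) * b t)"
    using slowly_varying_weight[OF b] by blast
  have "ennreal (s powr (-\<theta>) * b s) * modulus M X f s
      \<le> ennreal (K * (C * 2 powr n)) * (ennreal (t powr (-\<theta>) * b t) * modulus M X f t)"
    if f: "f \<in> borel_measurable M" and st: "0 < s" "s \<le> t" "t \<le> 2 * s" for f s t
  proof -
    have "0 \<le> b t" using b st by (auto simp: slowly_varying_def intro: less_imp_le)
    have "ennreal (s powr (-\<theta>) * b s) * modulus M X f s
        \<le> ennreal (K * (t powr (-\<theta>) * b t)) * (ennreal (C * 2 powr n) * modulus M X f t)"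
      by (intro mult_mono ennreal_leI K(2) modulus_doubling ri_norm_lattice X f st) auto
    also have "\<dots> = ennreal (K * (C * 2 powr n)) * (ennreal (t powr (-\<theta>) * b t) * modulus M X f t)"
      using K(1) C_ge_1 \<open>0 \<le> b t\<close> by (simp add: ennreal_mult ac_simps)
    finally show ?thesis .
  qed
  then show ?thesis using K(1) C_ge_1 by (intro exI[of _ "K * (C * 2 powr n)"]) auto
qed

text \<open>The integrand satisfies the dyadic comparison on the whole half-line, so the general
  estimates apply with remainder \<open>R = 0\<close>.\<close>

lemma hom_besov_chain:
  assumes X: "ri_norm M X" and F: "exact_interpolation_functor F" and b: "slowly_varying b"
  shows "embedded (hom_besov M X (tilde L1_norm) \<theta> b) (hom_besov_norm M X (tilde L1_norm) \<theta> b)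
           (hom_besov M X (tilde F) \<theta> b) (hom_besov_norm M X (tilde F) \<theta> b)"
    and "embedded (hom_besov M X (tilde F) \<theta> b) (hom_besov_norm M X (tilde F) \<theta> b)
           (hom_besov M X (tilde Linf_norm) \<theta> b) (hom_besov_norm M X (tilde Linf_norm) \<theta> b)"
proof -
  define \<phi> where "\<phi> f t = ennreal (t powr (-\<theta>) * b t) * modulus M X f t" for f t
  obtain K where K: "K > 0" "\<And>f s t. f \<in> borel_measurable M \<Longrightarrow> 0 < s \<Longrightarrow> s \<le> t \<Longrightarrow> t \<le> 2 * s \<Longrightarrow>
      \<phi> f s \<le> ennreal K * \<phi> f t"
    using besov_integrand_doubling[OF X b, of \<theta>] unfolding \<phi>_def by blast
  have meas: "\<phi> f \<in> borel_measurable dt_over_t" if "f \<in> borel_measurable M" for f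
    unfolding \<phi>_def by (rule besov_integrand_measurable[OF X b that])
  have alt: "\<forall>s>0. (\<forall>t\<in>{s..2 * s}. \<phi> f s \<le> ennreal K * \<phi> f t) \<or> \<phi> f s \<le> 0"
    if "f \<in> borel_measurable M" for f
    using K(2)[OF that] by auto
  \<comment> \<open>Both inclusions follow in the same way: the inequality between the norms of the
    integrand also transfers finiteness, hence membership.\<close>
  have emb: "embedded (hom_besov M X N \<theta> b) (hom_besov_norm M X N \<theta> b)
      (hom_besov M X N' \<theta> b) (hom_besov_norm M X N' \<theta> b)"
    if "C > 0" "\<And>f. f \<in> borel_measurable M \<Longrightarrow> N' (\<phi> f) \<le> ennreal C * (N (\<phi> f) + 0)" for N N' C
  proof -
    have le: "hom_besov_norm M X N' \<theta> b f \<le> ennreal C * hom_besov_norm M X N \<theta> b f"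
      if "f \<in> L1_plus_Linf M" for f
      using that \<open>\<And>f. f \<in> borel_measurable M \<Longrightarrow> N' (\<phi> f) \<le> ennreal C * (N (\<phi> f) + 0)\<close>[of f]
      unfolding hom_besov_norm_def \<phi>_def by (simp add: L1_plus_Linf_measurable)
    have "hom_besov_norm M X N' \<theta> b f < \<infinity>"
      if "f \<in> L1_plus_Linf M" "hom_besov_norm M X N \<theta> b f < \<infinity>" for f
      using le[OF that(1)] that(2) by (auto simp: ennreal_mult_less_top elim!: le_less_trans)
    then show ?thesis
      using le \<open>C > 0\<close> unfolding embedded_def hom_besov_def by blast
  qed
  obtain C where C: "C > 0" "\<And>g R. g \<in> borel_measurable dt_over_t \<Longrightarrow>
      \<forall>s>0. (\<forall>t\<in>{s..2 * s}. g s \<le> ennreal K * g t) \<or> g s \<le> R \<Longrightarrow>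
      tilde F g \<le> ennreal C * (tilde L1_norm g + R)"
    using tilde_le_L1_norm[OF F less_imp_le[OF K(1)]] by blast
  show "embedded (hom_besov M X (tilde L1_norm) \<theta> b) (hom_besov_norm M X (tilde L1_norm) \<theta> b)
           (hom_besov M X (tilde F) \<theta> b) (hom_besov_norm M X (tilde F) \<theta> b)"
    by (rule emb[OF C(1)]) (rule C(2)[OF meas alt])
  obtain C where C: "C > 0" "\<And>g R. g \<in> borel_measurable dt_over_t \<Longrightarrow>
      \<forall>s>0. (\<forall>t\<in>{s..2 * s}. g s \<le> ennreal K * g t) \<or> g s \<le> R \<Longrightarrow>
      tilde Linf_norm g \<le> ennreal C * (tilde F g + R)"
    using Linf_norm_le_tilde[OF F less_imp_le[OF K(1)]] by blast
  show "embedded (hom_besov M X (tilde F) \<theta> b) (hom_besov_norm M X (tilde F) \<theta> b)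
           (hom_besov M X (tilde Linf_norm) \<theta> b) (hom_besov_norm M X (tilde Linf_norm) \<theta> b)"
    by (rule emb[OF C(1)]) (rule C(2)[OF meas alt])
qed

text \<open>The cut-off destroys the dyadic comparison only for \<open>s\<close> in
  \<open>[1/2, 1)\<close>. The remainder \<open>R\<close> for these \<open>s\<close> is a multiple
  of \<open>fnorm X f\<close>, which the inhomogeneous norm contains.\<close>

lemma besov_chain:
  assumes X: "ri_norm M X" and F: "exact_interpolation_functor F" and b: "slowly_varying b"
  shows "embedded (besov M X (tilde L1_norm) \<theta> b) (besov_norm M X (tilde L1_norm) \<theta> b)
           (besov M X (tilde F) \<theta> b) (besov_norm M X (tilde F) \<theta> b)"
    and "embedded (besov M X (tilde F) \<theta> b) (besov_norm M X (tilde F) \<theta> b)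
           (besov M X (tilde Linf_norm) \<theta> b) (besov_norm M X (tilde Linf_norm) \<theta> b)"
proof -
  define \<phi> where "\<phi> f t = ennreal (t powr (-\<theta>) * b t) * modulus M X f t" for f t
  define \<psi> where "\<psi> f t = \<phi> f t * indicator {0<..<1} t" for f t
  obtain K where K: "K > 0" "\<And>f s t. f \<in> borel_measurable M \<Longrightarrow> 0 < s \<Longrightarrow> s \<le> t \<Longrightarrow> t \<le> 2 * s \<Longrightarrow>
      \<phi> f s \<le> ennreal K * \<phi> f t"
    using besov_integrand_doubling[OF X b, of \<theta>] unfolding \<phi>_def by blast
  obtain A where A: "0 \<le> A" "\<And>f. f \<in> borel_measurable M \<Longrightarrow> modulus M X f 1 \<le> ennreal A * fnorm X f"
    using modulus_one_le[OF X] by blast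
  have b1: "b 1 > 0" using b by (simp add: slowly_varying_def)
  \<comment> \<open>The comparison factor from \<open>s\<close> to 1, times the weight at 1, which
    is \<open>b 1\<close>, times the bound for the modulus at 1.\<close>
  define B where "B = K * (b 1 * A)"
  have B: "0 \<le> B" using K(1) A(1) b1 by (simp add: B_def)
  have meas: "\<psi> f \<in> borel_measurable dt_over_t" if "f \<in> borel_measurable M" for f
  proof -
    have "(\<lambda>t. indicator {0<..<1} t :: ennreal) \<in> borel_measurable dt_over_t"
      by (rule borel_measurable_dt_over_t) measurable
    then show ?thesis
      using besov_integrand_measurable[OF X b that, of \<theta>] unfolding \<psi>_def \<phi>_def by measurable
  qed
  have alt: "\<forall>s>0. (\<forall>t\<in>{s..2 * s}. \<psi> f s \<le> ennreal K * \<psi> f t) \<or> \<psi> f s \<le> ennreal B * fnorm X f"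
    if f: "f \<in> borel_measurable M" for f
  proof (intro allI impI)
    fix s :: real assume s: "s > 0"
    \<comment> \<open>In the first case \<open>[s, 2s]\<close> stays inside \<open>(0, 1)\<close>;
      in the second it contains the point 1, where the modulus is bounded by the norm in
      \<open>X\<close>; in the third the cut-off makes \<open>\<psi> f s\<close> vanish.\<close>
    consider "2 * s < 1" | "1 \<le> 2 * s" "s < 1" | "1 \<le> s" by linarith
    then show "(\<forall>t\<in>{s..2 * s}. \<psi> f s \<le> ennreal K * \<psi> f t) \<or> \<psi> f s \<le> ennreal B * fnorm X f"
    proof cases
      case 1
      then have "\<psi> f s \<le> ennreal K * \<psi> f t" if "t \<in> {s..2 * s}" for t
        using K(2)[OF f s, of t] that s by (simp add: \<psi>_def)
      then show ?thesis by blast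
    next
      case 2
      have "\<psi> f s \<le> ennreal K * \<phi> f 1" using K(2)[OF f s, of 1] 2 s by (simp add: \<psi>_def)
      also have "\<dots> \<le> ennreal K * (ennreal (b 1) * (ennreal A * fnorm X f))"
        unfolding \<phi>_def using A(2)[OF f] by (intro mult_left_mono) (auto intro: mult_left_mono)
      also have "\<dots> = ennreal B * fnorm X f"
        using K(1) b1 A(1) by (simp add: B_def ennreal_mult mult.assoc)
      finally show ?thesis by blast
    next
      case 3
      then show ?thesis by (simp add: \<psi>_def)
    qed
  qed
  have emb: "embedded (besov M X N \<theta> b) (besov_norm M X N \<theta> b) (besov M X N' \<theta> b) (besov_norm M X N' \<theta> b)"
    if hom: "embedded (hom_besov M X N \<theta> b) (hom_besov_norm M X N \<theta> b)
        (hom_besov M X N' \<theta> b) (hom_besov_norm M X N' \<theta> b)" and C: "C > 0"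
      and le: "\<And>f. f \<in> borel_measurable M \<Longrightarrow>
        N' (\<psi> f) \<le> ennreal C * (N (\<psi> f) + ennreal B * fnorm X f)" for N N' C
    unfolding embedded_def
  \<comment> \<open>\<open>C * (1 + B)\<close> serves the cut-off term, the additional 1 the term
    \<open>fnorm X f\<close>.\<close>
  proof (intro conjI exI[of _ "C * (1 + B) + 1"] ballI)
    \<comment> \<open>Membership is defined by the homogeneous seminorm, so the inclusion of sets is
      inherited from the homogeneous chain; the cut-off matters for the norm estimate only.\<close>
    show "besov M X N \<theta> b \<subseteq> besov M X N' \<theta> b"
      using hom by (auto simp: embedded_def besov_def)
    show "0 < C * (1 + B) + 1" using C B by (simp add: add_pos_nonneg)
    fix f assume "f \<in> besov M X N \<theta> b"
    then have f: "f \<in> borel_measurable M" by (simp add: besov_def fspace_def)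
    have norm_eq: "besov_norm M X P \<theta> b f = P (\<psi> f) + fnorm X f" for P
      unfolding besov_norm_def \<psi>_def \<phi>_def ..
    have "N' (\<psi> f) \<le> ennreal C * (N (\<psi> f) + ennreal B * fnorm X f)" by (rule le[OF f])
    also have "\<dots> \<le> ennreal C * (ennreal (1 + B) * (N (\<psi> f) + fnorm X f))"
    proof (rule mult_left_mono)
      have "1 * N (\<psi> f) \<le> ennreal (1 + B) * N (\<psi> f)" "ennreal B * fnorm X f \<le> ennreal (1 + B) * fnorm X f"
        using B by (intro mult_right_mono; simp add: ennreal_leI)+
      then show "N (\<psi> f) + ennreal B * fnorm X f \<le> ennreal (1 + B) * (N (\<psi> f) + fnorm X f)"
        unfolding distrib_left by (intro add_mono) auto
    qed simp
    also have "\<dots> = ennreal (C * (1 + B)) * (N (\<psi> f) + fnorm X f)"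
      using C B by (simp only: ennreal_mult mult.assoc less_imp_le add_nonneg_nonneg zero_le_one)
    finally have "N' (\<psi> f) + fnorm X f
        \<le> ennreal (C * (1 + B)) * (N (\<psi> f) + fnorm X f) + 1 * (N (\<psi> f) + fnorm X f)"
      by (intro add_mono) auto
    also have "\<dots> = ennreal (C * (1 + B) + 1) * (N (\<psi> f) + fnorm X f)"
      unfolding distrib_right[symmetric] using C B by (subst ennreal_plus) auto
    finally show "besov_norm M X N' \<theta> b f \<le> ennreal (C * (1 + B) + 1) * besov_norm M X N \<theta> b f"
      by (simp only: norm_eq)
  qed
  obtain C where C: "C > 0" "\<And>g R. g \<in> borel_measurable dt_over_t \<Longrightarrow>
      \<forall>s>0. (\<forall>t\<in>{s..2 * s}. g s \<le> ennreal K * g t) \<or> g s \<le> R \<Longrightarrow>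
      tilde F g \<le> ennreal C * (tilde L1_norm g + R)"
    using tilde_le_L1_norm[OF F less_imp_le[OF K(1)]] by blast
  show "embedded (besov M X (tilde L1_norm) \<theta> b) (besov_norm M X (tilde L1_norm) \<theta> b)
           (besov M X (tilde F) \<theta> b) (besov_norm M X (tilde F) \<theta> b)"
    by (rule emb[OF hom_besov_chain(1)[OF X F b] C(1)]) (rule C(2)[OF meas alt])
  obtain C where C: "C > 0" "\<And>g R. g \<in> borel_measurable dt_over_t \<Longrightarrow>
      \<forall>s>0. (\<forall>t\<in>{s..2 * s}. g s \<le> ennreal K * g t) \<or> g s \<le> R \<Longrightarrow>
      tilde Linf_norm g \<le> ennreal C * (tilde F g + R)"
    using Linf_norm_le_tilde[OF F less_imp_le[OF K(1)]] by blast
  show "embedded (besov M X (tilde F) \<theta> b) (besov_norm M X (tilde F) \<theta> b)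
           (besov M X (tilde Linf_norm) \<theta> b) (besov_norm M X (tilde Linf_norm) \<theta> b)"
    by (rule emb[OF hom_besov_chain(2)[OF X F b] C(1)]) (rule C(2)[OF meas alt])
qed

end

theorem proposition5:
  fixes M :: "'a::metric_space measure"
    and X :: "('a \<Rightarrow> ennreal) \<Rightarrow> ennreal"
    and E :: "(real \<Rightarrow> ennreal) \<Rightarrow> ennreal"
    and F :: "real measure \<Rightarrow> (real \<Rightarrow> ennreal) \<Rightarrow> ennreal"
    and b :: "real \<Rightarrow> real"
    and k n \<theta> :: real
  assumes "RD_space M k n"
    and "ri_norm M X"
    and "ri_norm leb_pos E"
    and "exact_interpolation_functor F"
    and "\<And>g. g \<in> borel_measurable leb_pos \<Longrightarrow> E g = F leb_pos g"
    and "slowly_varying b"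
    and "0 < \<theta>"
  shows "embedded (hom_besov M X (tilde L1_norm) \<theta> b) (hom_besov_norm M X (tilde L1_norm) \<theta> b)
           (hom_besov M X (tilde F) \<theta> b) (hom_besov_norm M X (tilde F) \<theta> b) \<and>
         embedded (hom_besov M X (tilde F) \<theta> b) (hom_besov_norm M X (tilde F) \<theta> b)
           (hom_besov M X (tilde Linf_norm) \<theta> b) (hom_besov_norm M X (tilde Linf_norm) \<theta> b) \<and>
         embedded (besov M X (tilde L1_norm) \<theta> b) (besov_norm M X (tilde L1_norm) \<theta> b)
           (besov M X (tilde F) \<theta> b) (besov_norm M X (tilde F) \<theta> b) \<and>
         embedded (besov M X (tilde F) \<theta> b) (besov_norm M X (tilde F) \<theta> b)
           (besov M X (tilde Linf_norm) \<theta> b) (besov_norm M X (tilde Linf_norm) \<theta> b)"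
proof -
  obtain C where "doubling_space M C n" using RD_space_doubling_space[OF assms(1)] by blast
  then interpret doubling_space M C n .
  show ?thesis
    using hom_besov_chain[OF assms(2,4,6), of \<theta>] besov_chain[OF assms(2,4,6), of \<theta>] by simp
qed

end
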